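(* For all $n\geq1$, \[|\mathrm{Av}^\star_{3n}(132)|=2\sum_{k=1}^{n}\sum_{(x_1,\dots,x_k)\in\mathcal{P}_{n,k}} a_{x_1}a_{x_2}\cdots a_{x_k},\] where $\mathcal{P}_{n,k}$ is the set of compositions of $n$ with $k$ parts and $a_m=|\mathcal{A}_{3m}|$. Furthermore, $B(x)=\sum_{n\ge1}|\mathrm{Av}^\star_{3n}(132)|x^n$ is given by \[B(x)=\frac{2A(x)}{1-A(x)},\qquad A(x)=(c(x)-1)\,m(c(x)-1),\] where $c(x)=\sum_{n\ge0}C_nx^n$ and $m(x)=\sum_{n\ge0}M_nx^n$.
   Context: Permutations are written in one-line notation $\pi=\pi_1\cdots\pi_m$, $\pi_i=\pi(i)$; a permutation avoids $\sigma$ if no subsequence is in the same relative order as $\sigma$. $\mathcal{S}^\star_{3n}$ is the set of permutations of $[3n]$ whose cycle decomposition consists only of 3-cycles, and $\mathrm{Av}^\star_{3n}(132)$ is the set of those avoiding 132. If $\{a<b<c\}$ is a 3-cycle of $\pi$, $\pi_a\pi_b\pi_c$ is in relative order 312 or 231, and the cycle is called of the form 312 or 231 accordingly. $\mathcal{A}_{3m}$ is the set of permutations in $\mathrm{Av}^\star_{3m}(132)$ all of whose 3-cycles are of the form 312. $C_m=\frac{1}{m+1}\binom{2m}{m}$ are the Catalan numbers and $M_m$ the Motzkin numbers ($M_m$ = number of lattice paths from $(0,0)$ to $(m,0)$ with steps $(1,1),(1,0),(1,-1)$ never going below the $x$-axis; $M_0=1$). *)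

theory Defs
  imports
    "HOL-Combinatorics.Combinatorics"
    "HOL-Computational_Algebra.Formal_Power_Series"
    "HOL-Library.Sublist"
    "HOL-Library.Product_Plus"
begin

definition same_relative_order :: "nat list \<Rightarrow> nat list \<Rightarrow> bool" where
  "same_relative_order xs ys \<longleftrightarrow>
     length xs = length ys \<and>
     (\<forall>i<length xs. \<forall>j<length xs. xs ! i < xs ! j \<longleftrightarrow> ys ! i < ys ! j)"

definition one_line :: "nat \<Rightarrow> (nat \<Rightarrow> nat) \<Rightarrow> nat list" where
  "one_line m p = map p [1..<m + 1]"

definition avoids :: "nat list \<Rightarrow> nat list \<Rightarrow> bool" where
  "avoids w \<sigma> \<longleftrightarrow> \<not> (\<exists>v. subseq v w \<and> same_relative_order v \<sigma>)"

text \<open>The cycles of a permutation are represented by their underlying sets, the orbits.\<close>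

definition cycles_of :: "nat \<Rightarrow> (nat \<Rightarrow> nat) \<Rightarrow> nat set set" where
  "cycles_of m p = orbit p ` {1..m}"

definition S_star :: "nat \<Rightarrow> (nat \<Rightarrow> nat) set" where
  "S_star m = {p. p permutes {1..m} \<and> (\<forall>C\<in>cycles_of m p. card C = 3)}"

definition Av_star :: "nat \<Rightarrow> nat list \<Rightarrow> (nat \<Rightarrow> nat) set" where
  "Av_star m \<sigma> = {p \<in> S_star m. avoids (one_line m p) \<sigma>}"

definition cycle_has_form :: "(nat \<Rightarrow> nat) \<Rightarrow> nat set \<Rightarrow> nat list \<Rightarrow> bool" where
  "cycle_has_form p C \<tau> \<longleftrightarrow> same_relative_order (map p (sorted_list_of_set C)) \<tau>"

definition A_set :: "nat \<Rightarrow> (nat \<Rightarrow> nat) set" where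
  "A_set m = {p \<in> Av_star m [1, 3, 2]. \<forall>C\<in>cycles_of m p. cycle_has_form p C [3, 1, 2]}"

definition compositions :: "nat \<Rightarrow> nat \<Rightarrow> nat list set" where
  "compositions n k = {xs. length xs = k \<and> (\<forall>x\<in>set xs. x \<ge> 1) \<and> sum_list xs = n}"

definition catalan :: "nat \<Rightarrow> rat" where
  "catalan m = 1 / (of_nat m + 1) * of_nat ((2 * m) choose m)"

text \<open>A lattice path is the list of its steps; the points it visits are the partial sums.\<close>

definition motzkin_paths :: "nat \<Rightarrow> (int \<times> int) list set" where
  "motzkin_paths m = {s. set s \<subseteq> {(1, 1), (1, 0), (1, -1)} \<and>
     sum_list s = (int m, 0) \<and> (\<forall>k\<le>length s. snd (sum_list (take k s)) \<ge> 0)}"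

definition motzkin :: "nat \<Rightarrow> nat" where
  "motzkin m = card (motzkin_paths m)"

end

theory Submission
  imports Defs
begin

text \<open>
  If a is the least element of a 3-cycle of a 132-avoiding permutation p, then every earlier position
  carries a value above a. Hence cycles of the two forms are nested: the cycles of form 312 that
  precede the first cycle of form 231 form an element of A, and all remaining cycles sit in one
  central block, in which they form an arbitrary 132-avoiding permutation starting with form 231.
  Inversion exchanges the two forms, so the permutations starting with form 312 have generating
  function V = A (1 + V), and B = 2 V.

  For A, the cycles of an element are (r i, c i, b i), where both b and c are increasing and
  b i < c i. So the element is given by a Dyck path (the shuffle of b and c) and a 132-avoiding
  permutation r, and it avoids 132 iff each non-inversion i < l of r has neither two of b i, ..., b l
  nor two of c i, ..., c l separated by an entry of the other sequence. Cut the indices where one of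
  the two sequences is interrupted. Then r is a skew sum of 132-avoiding permutations of the pieces,
  counted by the Catalan numbers, and the types of the successive cuts (only c, only b, both) are the
  up, down and level steps of a Motzkin path, which gives A = (c - 1) m(c - 1).
\<close>

section \<open>132-avoiding permutations with 3-cycles\<close>

text \<open>Why the cuts form a Motzkin path: record the Dyck path by the numbers
  \<open>f ! i\<close> of down steps before up step i. A positive value v of \<open>f\<close>
  interrupts the down steps between v - 1 and v, and it interrupts the up steps just before the
  first index at which \<open>f\<close> takes the value v. As \<open>f ! i <= i\<close>, the first
  event never comes after the second. Both kinds of events occur in increasing order of v, so they
  are matched like arrivals and departures of a queue. Hence the word of cut types never falls below
  height 0, returns to 0, and determines the path. A word with j cuts has j + 1 nonempty blocks,
  each with generating function c(x) - 1. So A is the sum of M_j (c(x) - 1)^(j+1), which explains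
  both the factor c(x) - 1 and the substitution into m. Since a cut may change the height, the proof
  compares two families of series, one for words and one for Motzkin paths, indexed by the starting
  height.\<close>

definition three_cyclic :: "nat \<Rightarrow> (nat \<Rightarrow> nat) \<Rightarrow> bool" where
  "three_cyclic m p \<longleftrightarrow> p permutes {1..m} \<and> (\<forall>x\<in>{1..m}. p x \<noteq> x \<and> p (p (p x)) = x)"

text \<open>Positions are not bounded by m: a permutation of \<open>{1..m}\<close> fixes every
  larger point, and such a point is at least as large as all earlier values, so it cannot end a 132
  pattern. The bound 1 from below matters, because the fixed point 0 would complete a pattern with
  any descent.\<close>

definition no132 :: "(nat \<Rightarrow> nat) \<Rightarrow> bool" where
  "no132 p \<longleftrightarrow> (\<forall>i j k. 1 \<le> i \<longrightarrow> i < j \<longrightarrow> j < k \<longrightarrow> \<not> (p i < p k \<and> p k < p j))"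

lemma no132D: "no132 p \<Longrightarrow> 1 \<le> i \<Longrightarrow> i < j \<Longrightarrow> j < k \<Longrightarrow> p i < p k \<Longrightarrow> p k < p j \<Longrightarrow> False"
  by (auto simp: no132_def)

text \<open>The inequalities hold only at the least element of a cycle, so each cycle of form 231 is
  named once, by its minimum.\<close>

definition has_231_cycle_at :: "(nat \<Rightarrow> nat) \<Rightarrow> nat \<Rightarrow> bool" where
  "has_231_cycle_at p x \<longleftrightarrow> x < p x \<and> p x < p (p x)"

lemma permutes_interval_le:
  assumes "p permutes {1..m::nat}" "x \<le> n" "m \<le> n"
  shows "p x \<le> n"
proof (cases "x \<in> {1..m}")
  case True
  then have "p x \<in> {1..m}" using assms(1) by (simp only: permutes_in_image)
  then show ?thesis using assms by simp
next
  case False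
  then have "p x = x" using assms(1) by (simp add: permutes_not_in)
  then show ?thesis using assms by simp
qed

section \<open>From words and orbits to pointwise conditions\<close>

lemma same_relative_order_3:
  "same_relative_order [x, y, z] [a, b, c] \<longleftrightarrow>
     (x < y \<longleftrightarrow> a < b) \<and> (y < x \<longleftrightarrow> b < a) \<and> (x < z \<longleftrightarrow> a < c) \<and>
     (z < x \<longleftrightarrow> c < a) \<and> (y < z \<longleftrightarrow> b < c) \<and> (z < y \<longleftrightarrow> c < b)"
  by (auto simp: same_relative_order_def less_Suc_eq all_conj_distrib)

lemma upt_split: "i \<le> j \<Longrightarrow> j \<le> k \<Longrightarrow> [i..<k] = [i..<j] @ [j..<k]"
  using upt_add_eq_append[of i j "k - j"] by simp

lemma avoids_132_iff:
  assumes "p permutes {1..m}"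
  shows "avoids (one_line m p) [1, 3, 2] \<longleftrightarrow> no132 p"
proof
  assume av: "avoids (one_line m p) [1, 3, 2]"
  show "no132 p" unfolding no132_def
  proof (intro allI impI notI)
    fix i j k :: nat assume ijk: "1 \<le> i" "i < j" "j < k" and pat: "p i < p k \<and> p k < p j"
    have "k \<le> m"
    proof (rule ccontr)
      assume "\<not> k \<le> m"
      then have "p k = k" using assms by (simp add: permutes_not_in)
      moreover have "p j \<le> k" using permutes_interval_le[OF assms, of j k] ijk \<open>\<not> k \<le> m\<close> by simp
      ultimately show False using pat by simp
    qed
    have "[1..<m+1] = [1..<i] @ [i..<j] @ [j..<k] @ [k..<m+1]"
      using ijk \<open>k \<le> m\<close> upt_split[of 1 i "m+1"] upt_split[of i j "m+1"] upt_split[of j k "m+1"] by simp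
    moreover have "subseq [i] [i..<j]" "subseq [j] [j..<k]" "subseq [k] [k..<m+1]"
      using ijk \<open>k \<le> m\<close> by (auto simp: subseq_singleton_left)
    then have "subseq ([i] @ [j] @ [k]) ([i..<j] @ [j..<k] @ [k..<m+1])"
      by (intro list_emb_append_mono)
    ultimately have "subseq [i, j, k] [1..<m+1]"
      by (metis append.left_neutral append_Cons list_emb_append2)
    then have "subseq (map p [i, j, k]) (one_line m p)"
      unfolding one_line_def by (rule subseq_map)
    moreover have "same_relative_order (map p [i, j, k]) [1, 3, 2]"
      using pat by (simp add: same_relative_order_3)
    ultimately show False using av by (auto simp: avoids_def)
  qed
next
  assume no: "no132 p"
  show "avoids (one_line m p) [1, 3, 2]" unfolding avoids_def
  proof
    assume "\<exists>v. subseq v (one_line m p) \<and> same_relative_order v [1, 3, 2]"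
    then obtain v where v: "subseq v (map p [1..<m+1])" "same_relative_order v [1, 3, 2]"
      by (auto simp: one_line_def)
    then obtain N where "v = nths (map p [1..<m+1]) N" by (auto simp: subseq_conv_nths)
    then have vm: "v = map p (nths [1..<m+1] N)" by (simp add: nths_map)
    define xs where "xs = nths [1..<m+1] N"
    have "sorted xs" unfolding xs_def by (rule sorted_nths[OF sorted_upt])
    moreover have "distinct xs" unfolding xs_def by (rule distinct_nthsI[OF distinct_upt])
    moreover have "set xs \<subseteq> {1..m}"
      unfolding xs_def using set_nths_subset[of "[1..<m+1]" N] by auto
    moreover have "length xs = 3" using v vm unfolding xs_def same_relative_order_def by simp
    then obtain i j k where xs: "xs = [i, j, k]" by (auto simp: numeral_eq_Suc length_Suc_conv)
    ultimately have ijk: "1 \<le> i" "i < j" "j < k" by auto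
    moreover have "p i < p k" "p k < p j"
      using v(2) vm xs unfolding xs_def[symmetric] by (simp_all add: same_relative_order_3)
    ultimately show False using no no132D by blast
  qed
qed

lemma orbit_cube:
  assumes "p (p (p x)) = x"
  shows "orbit p x = {x, p x, p (p x)}"
proof
  have "y \<in> {x, p x, p (p x)}" if "y \<in> orbit p x" for y
    using that by induction (use assms in auto)
  then show "orbit p x \<subseteq> {x, p x, p (p x)}" by blast
  have "p x \<in> orbit p x" by (rule orbit.base)
  moreover from this have "p (p x) \<in> orbit p x" by (rule orbit.step)
  moreover from this have "p (p (p x)) \<in> orbit p x" by (rule orbit.step)
  ultimately show "{x, p x, p (p x)} \<subseteq> orbit p x" using assms by simp
qed

lemma card_orbit_eq_3_iff:
  assumes "p permutes S" "finite S"
  shows "card (orbit p x) = 3 \<longleftrightarrow> p x \<noteq> x \<and> p (p (p x)) = x"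
proof
  have self: "x \<in> orbit p x"
    using assms by (auto intro!: permutation_self_in_orbit simp: permutation_permutes)
  show "p x \<noteq> x \<and> p (p (p x)) = x" if c: "card (orbit p x) = 3"
  proof -
    have "p x \<noteq> x" using c orbit_eq_singleton_iff[of p x] by fastforce
    \<comment> \<open>\<open>funpow_dist1 p x x\<close> is the first positive return time of x,
      hence the size of the orbit.\<close>
    moreover have "card (orbit p x) = funpow_dist1 p x x"
      using orbit_conv_funpow_dist1[OF self] inj_on_funpow_dist1[OF self]
      by (simp add: card_image)
    then have "(p ^^ 3) x = x" using funpow_dist1_prop[OF self] c by simp
    ultimately show ?thesis by (simp add: numeral_eq_Suc)
  qed
  show "card (orbit p x) = 3" if c: "p x \<noteq> x \<and> p (p (p x)) = x"
  proof -
    have "p (p x) \<noteq> p x" using c assms(1) by metis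
    moreover have "p (p x) \<noteq> x" using c by metis
    moreover have "x \<noteq> p x" using conjunct1[OF c] by (rule not_sym)
    ultimately show ?thesis using c orbit_cube[of p x] by (simp add: card_insert_if)
  qed
qed

lemma Av_star_132_iff:
  "p \<in> Av_star m [1, 3, 2] \<longleftrightarrow> three_cyclic m p \<and> no132 p"
proof -
  have "p \<in> S_star m \<longleftrightarrow> three_cyclic m p"
    unfolding S_star_def three_cyclic_def cycles_of_def
    using card_orbit_eq_3_iff[of p "{1..m}"] by auto
  then show ?thesis
    unfolding Av_star_def using avoids_132_iff[of p m] by (auto simp: three_cyclic_def)
qed

lemma three_cyclic_facts:
  assumes "three_cyclic m p" "x \<in> {1..m}"
  shows "p x \<noteq> x" "p (p x) \<noteq> x" "p (p x) \<noteq> p x" "p (p (p x)) = x" "p x \<in> {1..m}" "p (p x) \<in> {1..m}"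
proof -
  have P: "p permutes {1..m}" and H: "p x \<noteq> x" "p (p (p x)) = x"
    using assms by (auto simp: three_cyclic_def)
  show "p x \<noteq> x" "p (p (p x)) = x" by fact+
  show "p (p x) \<noteq> x" using H by metis
  show "p (p x) \<noteq> p x" using H by metis
  show "p x \<in> {1..m}" using P assms(2) by (simp only: permutes_in_image)
  then show "p (p x) \<in> {1..m}" using P by (simp only: permutes_in_image)
qed

lemma three_cyclic_inj: "three_cyclic m p \<Longrightarrow> p x = p y \<longleftrightarrow> x = y"
  by (metis permutes_def three_cyclic_def)

text \<open>Three points carry only two cyclic orders. Form 231 is the one in which the cycle, read
  from its minimum, increases twice; the six orders of x, \<open>p x\<close>, \<open>p (p x)\<close>
  split accordingly.\<close>

lemma cycle_has_form_312_iff: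
  assumes "three_cyclic m p" "x \<in> {1..m}"
  shows "cycle_has_form p (orbit p x) [3, 1, 2] \<longleftrightarrow>
    (\<forall>y\<in>orbit p x. \<not> has_231_cycle_at p y)"
proof -
  obtain y z where yz: "p x = y" "p y = z" "p z = x"
    using that[OF refl refl three_cyclic_facts(4)[OF assms]] .
  then have orb: "orbit p x = {x, y, z}" using orbit_cube[of p x] by simp
  have ne: "x \<noteq> y" "y \<noteq> z" "x \<noteq> z"
    using three_cyclic_facts(1-3)[OF assms] yz by auto
  consider "x < y \<and> y < z" | "x < z \<and> z < y" | "y < x \<and> x < z" | "y < z \<and> z < x"
    | "z < x \<and> x < y" | "z < y \<and> y < x"
    using ne by linarith
  then show ?thesis
    unfolding orb cycle_has_form_def has_231_cycle_at_def
    by cases (simp_all add: yz same_relative_order_3)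
qed

lemma A_set_iff:
  "p \<in> A_set m \<longleftrightarrow> three_cyclic m p \<and> no132 p \<and> (\<forall>x. \<not> has_231_cycle_at p x)"
proof (cases "three_cyclic m p \<and> no132 p")
  case True
  then have P: "p permutes {1..m}" by (simp add: three_cyclic_def)
  have "(\<forall>C\<in>cycles_of m p. cycle_has_form p C [3, 1, 2]) \<longleftrightarrow>
        (\<forall>x\<in>{1..m}. \<forall>y\<in>orbit p x. \<not> has_231_cycle_at p y)"
    using True cycle_has_form_312_iff[of m p] by (auto simp: cycles_of_def)
  also have "\<dots> \<longleftrightarrow> (\<forall>x\<in>{1..m}. \<not> has_231_cycle_at p x)"
  proof safe
    fix x assume "x \<in> {1..m}" "\<forall>x\<in>{1..m}. \<forall>y\<in>orbit p x. \<not> has_231_cycle_at p y" "has_231_cycle_at p x"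
    moreover have "x \<in> orbit p x"
      using orbit_cube[of p x] three_cyclic_facts(4)[of m p x] True \<open>x \<in> {1..m}\<close> by blast
    ultimately show False by blast
  next
    fix x y assume H: "x \<in> {1..m}" "\<forall>x\<in>{1..m}. \<not> has_231_cycle_at p x" "y \<in> orbit p x" "has_231_cycle_at p y"
    have "y \<in> {1..m}" using permutes_orbit_subset[OF P H(1)] H(3) by blast
    then show False using H(2,4) by blast
  qed
  also have "\<dots> \<longleftrightarrow> (\<forall>x. \<not> has_231_cycle_at p x)"
    using permutes_not_in[OF P] by (auto simp: has_231_cycle_at_def)
  finally show ?thesis unfolding A_set_def mem_Collect_eq Av_star_132_iff using True by blast
next
  case False
  then show ?thesis unfolding A_set_def mem_Collect_eq Av_star_132_iff by blast
qed

text \<open>Skew-sum splittings produce two sets of values, one above the other; their sizes alone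
  then force both to be intervals.\<close>

lemma upper_lower_split:
  assumes "U \<union> L = {lo..<lo + n}" "\<forall>x\<in>U. \<forall>y\<in>L. y < x" "card U = i"
  shows "U = {lo + (n - i)..<lo + n} \<and> L = {lo..<lo + (n - i)}"
proof -
  have fin: "finite U" "finite L" using assms(1) by (metis finite_Un finite_atLeastLessThan)+
  have dis: "U \<inter> L = {}" using assms(2) by fastforce
  then have cards: "i + card L = n"
    using card_Un_disjoint[OF fin dis] assms(1,3) by simp
  have "\<forall>x\<in>U. lo + (n - i) \<le> x"
  proof
    fix x assume "x \<in> U"
    then have "L \<subseteq> {lo..<x}" using assms(1,2) by fastforce
    then have "card L \<le> x - lo" using card_mono[of "{lo..<x}" L] by simp
    moreover have "lo \<le> x" using \<open>x \<in> U\<close> assms(1) by fastforce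
    ultimately show "lo + (n - i) \<le> x" using cards by linarith
  qed
  then have "U \<subseteq> {lo + (n - i)..<lo + n}" using assms(1) by fastforce
  then have U: "U = {lo + (n - i)..<lo + n}"
    using card_subset_eq[of "{lo + (n - i)..<lo + n}" U] assms(3) cards by simp
  have "L = {lo..<lo + n} - U" using assms(1) dis by blast
  also have "\<dots> = {lo..<lo + (n - i)}" unfolding U using cards by auto
  finally show ?thesis using U by simp
qed

section \<open>Minima and nesting of cycles\<close>

lemma three_cyclic_outside: "three_cyclic m p \<Longrightarrow> x \<notin> {1..m} \<Longrightarrow> p x = x"
  unfolding three_cyclic_def by (erule conjE) (rule permutes_not_in)

lemma three_cyclic_cube:
  assumes "three_cyclic m p" shows "p (p (p x)) = x"
proof (cases "x \<in> {1..m}")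
  case True
  then show ?thesis by (rule three_cyclic_facts(4)[OF assms])
next
  case False
  show ?thesis by (simp only: three_cyclic_outside[OF assms False])
qed

lemma three_cyclic_ge_1:
  assumes "three_cyclic m p" "1 \<le> x" shows "1 \<le> p x"
proof (cases "x \<in> {1..m}")
  case True
  then show ?thesis using three_cyclic_facts(5)[OF assms(1)] by simp
next
  case False
  then show ?thesis using three_cyclic_outside[OF assms(1)] assms(2) by simp
qed

lemma three_cyclicI:
  assumes "\<And>x. x \<notin> {1..m} \<Longrightarrow> p x = x" "\<And>x. x \<in> {1..m} \<Longrightarrow> p x \<noteq> x" "\<And>x. p (p (p x)) = x"
  shows "three_cyclic m p"
proof -
  have "\<exists>!x. p x = y" for y
    by (rule ex1I[of _ "p (p y)"]) (use assms(3) in auto)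
  then show ?thesis using assms by (simp add: three_cyclic_def permutes_def)
qed

lemma three_cyclic_moved: "three_cyclic m p \<Longrightarrow> p x \<noteq> x \<Longrightarrow> x \<in> {1..m}"
  using three_cyclic_outside by blast

definition cycle_min :: "(nat \<Rightarrow> nat) \<Rightarrow> nat \<Rightarrow> bool" where
  "cycle_min p x \<longleftrightarrow> x < p x \<and> x < p (p x)"

lemma cycle_min_exists:
  assumes "three_cyclic m p" "x \<in> {1..m}"
  shows "\<exists>a. cycle_min p a \<and> (x = a \<or> x = p a \<or> x = p (p a))"
proof -
  obtain y z where yz: "p x = y" "p y = z" "p z = x"
    using that[OF refl refl three_cyclic_facts(4)[OF assms]] .
  have ne: "x \<noteq> y" "y \<noteq> z" "x \<noteq> z"
    using three_cyclic_facts(1-3)[OF assms] yz by auto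
  consider "x < y \<and> x < z" | "y < x \<and> y < z" | "z < x \<and> z < y"
    using ne by linarith
  then show ?thesis
  proof cases
    case 1 then show ?thesis using yz by (intro exI[of _ x]) (simp add: cycle_min_def)
  next
    case 2 then show ?thesis using yz by (intro exI[of _ y]) (simp add: cycle_min_def)
  next
    case 3 then show ?thesis using yz by (intro exI[of _ z]) (simp add: cycle_min_def)
  qed
qed

lemma has_231_imp_cycle_min: "has_231_cycle_at p x \<Longrightarrow> cycle_min p x"
  by (auto simp: has_231_cycle_at_def cycle_min_def)

text \<open>Otherwise the positions \<open>j < a < p (p a)\<close> carry the values
  \<open>p j\<close>, \<open>p a\<close>, \<open>a\<close> with \<open>p j < a < p a\<close>, a 132
  pattern. Equality \<open>p j = a\<close> is excluded because only the later position
  \<open>p (p a)\<close> carries a.\<close>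

lemma before_cycle_min:
  assumes "three_cyclic m p" "no132 p" "cycle_min p a" "1 \<le> j" "j < a"
  shows "a < p j"
proof (rule ccontr)
  assume "\<not> a < p j"
  have min: "a < p a" "a < p (p a)" using assms(3) by (auto simp: cycle_min_def)
  have cube: "p (p (p a)) = a" by (rule three_cyclic_cube[OF assms(1)])
  have "p j \<noteq> a"
  proof
    assume "p j = a"
    then have "j = p (p a)" using cube three_cyclic_inj[OF assms(1), of j "p (p a)"] by simp
    then show False using min assms(5) by simp
  qed
  then have "p j < a" using \<open>\<not> a < p j\<close> by simp
  then show False
    using no132D[OF assms(2,4), of a "p (p a)"] assms(5) min cube by simp
qed

text \<open>Let a < b < c be the 231 cycle and a' < b' < c' the 312 cycle, and suppose b' < c. If b'
  < b, positions b', b, c carry a', c, a; if b < b', positions a, b, c' carry b, c, b'. Both are 132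
  patterns.\<close>

lemma nested_231_in_312:
  assumes "three_cyclic m p" "no132 p"
    and "cycle_min p a'" "p (p a') < p a'" and "has_231_cycle_at p a" "1 \<le> a'" "a' < a"
  shows "p (p a) < p (p a')"
proof (rule ccontr)
  obtain b c where bc: "p a = b" "p b = c" "p c = a"
    using that[OF refl refl three_cyclic_cube[OF assms(1)]] .
  obtain b' c' where bc': "p a' = c'" "p c' = b'" "p b' = a'"
    using that[OF refl refl three_cyclic_cube[OF assms(1)]] .
  have o: "a < b" "b < c" "a' < b'" "b' < c'"
    using assms(3-5) bc bc' by (auto simp: has_231_cycle_at_def cycle_min_def)
  assume "\<not> p (p a) < p (p a')"
  then have "b' \<le> c" using bc bc' by simp
  moreover have "b' \<noteq> c" using bc bc' assms(7) by auto
  moreover have "b' \<noteq> b" using bc bc' assms(7) o by auto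
  ultimately consider "b' < b" | "b < b'" "b' < c" by linarith
  then show False
  proof cases
    case 1
    then show False using no132D[OF assms(2), of b' b c] bc bc' o assms(6,7) by simp
  next
    case 2
    then show False using no132D[OF assms(2), of a b c'] bc bc' o assms(6,7) by simp
  qed
qed

text \<open>With the same letters, suppose b < c'. If b' < b, positions b', b, c' carry a', c, b';
  if b < b', positions a, a', c' carry b, c', b'. Both are 132 patterns.\<close>

lemma nested_312_in_231:
  assumes "three_cyclic m p" "no132 p"
    and "cycle_min p a'" "p (p a') < p a'" and "has_231_cycle_at p a" "1 \<le> a" "a < a'"
  shows "p a' < p a"
proof (rule ccontr)
  obtain b c where bc: "p a = b" "p b = c" "p c = a"
    using that[OF refl refl three_cyclic_cube[OF assms(1)]] .
  obtain b' c' where bc': "p a' = c'" "p c' = b'" "p b' = a'"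
    using that[OF refl refl three_cyclic_cube[OF assms(1)]] .
  have o: "a < b" "b < c" "a' < b'" "b' < c'"
    using assms(3-5) bc bc' by (auto simp: has_231_cycle_at_def cycle_min_def)
  assume "\<not> p a' < p a"
  then have "b \<le> c'" using bc bc' by simp
  moreover have "b \<noteq> c'" using bc bc' assms(7) o by auto
  moreover have "b' \<noteq> b" using bc bc' assms(7) o by auto
  ultimately consider "b' < b" "b < c'" | "b < b'" by linarith
  then show False
  proof cases
    case 1
    then show False using no132D[OF assms(2), of b' b c'] bc bc' o assms(6,7) by simp
  next
    case 2
    then show False using no132D[OF assms(2), of a a' c'] bc bc' o assms(6,7) by simp
  qed
qed

section \<open>The form of the first cycle, and inversion\<close>

definition V312 :: "nat \<Rightarrow> (nat \<Rightarrow> nat) set" where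
  "V312 m = {p. three_cyclic m p \<and> no132 p \<and> p (p 1) < p 1}"

text \<open>For positive m, position 1 is the minimum of its cycle, so comparing \<open>p 1\<close>
  with \<open>p (p 1)\<close> decides the form of that cycle in both sets. For m = 0 the point 1 is
  fixed and both sets are empty.\<close>

definition V231 :: "nat \<Rightarrow> (nat \<Rightarrow> nat) set" where
  "V231 m = {p. three_cyclic m p \<and> no132 p \<and> p 1 < p (p 1)}"

lemma finite_three_cyclic: "finite {p. three_cyclic m p}"
  by (rule finite_subset[OF _ finite_permutations[of "{1..m}"]]) (auto simp: three_cyclic_def)

lemma finite_V312: "finite (V312 m)" and finite_V231: "finite (V231 m)"
  by (rule finite_subset[OF _ finite_three_cyclic[of m]]; auto simp: V312_def V231_def)+

lemma three_cyclic_square: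
  assumes "three_cyclic m p" shows "three_cyclic m (p \<circ> p)"
proof (rule three_cyclicI)
  fix x assume "x \<in> {1..m}"
  then show "(p \<circ> p) x \<noteq> x" using three_cyclic_facts(2)[OF assms] by simp
next
  fix x assume "x \<notin> {1..m}"
  then show "(p \<circ> p) x = x" using three_cyclic_outside[OF assms] by simp
qed (simp add: three_cyclic_cube[OF assms])

text \<open>The square of p is its inverse, and 132 is an involution: a pattern of the inverse at
  positions i < j < k becomes a pattern of p whose values, read from left to right, are i, k,
  j.\<close>

lemma no132_square:
  assumes "three_cyclic m p" "no132 p" shows "no132 (p \<circ> p)"
  unfolding no132_def
proof (intro allI impI notI)
  fix i j k :: nat
  assume ijk: "1 \<le> i" "i < j" "j < k" "(p \<circ> p) i < (p \<circ> p) k \<and> (p \<circ> p) k < (p \<circ> p) j"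
  have "1 \<le> p (p i)" using three_cyclic_ge_1[OF assms(1)] ijk(1) by simp
  then show False
    using no132D[OF assms(2), of "p (p i)" "p (p k)" "p (p j)"] ijk three_cyclic_cube[OF assms(1)] by simp
qed

lemma card_V231: "card (V231 m) = card (V312 m)"
proof (rule bij_betw_same_card)
  have sq: "(p \<circ> p) \<circ> (p \<circ> p) = p" if "three_cyclic m p" for p
    by (rule ext) (simp add: three_cyclic_cube[OF that])
  show "bij_betw (\<lambda>p. p \<circ> p) (V231 m) (V312 m)"
    by (rule bij_betw_byWitness[where f' = "\<lambda>p. p \<circ> p"])
      (auto simp: V231_def V312_def three_cyclic_square no132_square three_cyclic_cube sq simp del: comp_apply,
       auto simp: three_cyclic_cube)
qed

lemma card_Av_star_eq:
  assumes "1 \<le> m" shows "card (Av_star m [1, 3, 2]) = 2 * card (V312 m)"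
proof -
  have "Av_star m [1, 3, 2] = V312 m \<union> V231 m"
  proof (rule set_eqI)
    fix p
    have "p 1 < p (p 1) \<or> p (p 1) < p 1" if "three_cyclic m p"
      using three_cyclic_facts(3)[OF that, of 1] assms by fastforce
    then show "p \<in> Av_star m [1, 3, 2] \<longleftrightarrow> p \<in> V312 m \<union> V231 m"
      unfolding Av_star_132_iff V312_def V231_def by blast
  qed
  moreover have "V312 m \<inter> V231 m = {}" by (auto simp: V312_def V231_def)
  ultimately show ?thesis
    by (simp add: card_Un_disjoint finite_V312 finite_V231 card_V231)
qed

section \<open>Minima, and permutations with all cycles of form 312\<close>

lemma initial_segmentI:
  assumes "X \<subseteq> {1..}" "finite X" "card X = k" "\<And>x y. x \<in> X \<Longrightarrow> 1 \<le> y \<Longrightarrow> y < x \<Longrightarrow> y \<in> X"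
  shows "X = {1..k::nat}"
proof (cases "X = {}")
  case False
  define M where "M = Max X"
  have "M \<in> X" using False assms(2) by (simp add: M_def)
  have "X = {1..M}"
  proof
    show "X \<subseteq> {1..M}" using assms(1,2) M_def by auto
    show "{1..M} \<subseteq> X"
    proof
      fix y assume "y \<in> {1..M}"
      then show "y \<in> X" using assms(4)[OF \<open>M \<in> X\<close>, of y] \<open>M \<in> X\<close> by (cases "y = M") auto
    qed
  qed
  then show ?thesis using assms(3) by simp
qed (use assms in auto)

text \<open>A cycle has only one minimum, so the minima, their images and their second images do not
  meet. This is what allows counting by threes.\<close>

lemma cycles_of_minima:
  assumes "three_cyclic m p" "\<And>x. x \<in> X \<Longrightarrow> cycle_min p x" "finite X"
  shows "X \<inter> p ` X = {}" "X \<inter> (\<lambda>x. p (p x)) ` X = {}" "p ` X \<inter> (\<lambda>x. p (p x)) ` X = {}"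
    "card (p ` X) = card X" "card ((\<lambda>x. p (p x)) ` X) = card X"
proof -
  note cube = three_cyclic_cube[OF assms(1)] and inj = three_cyclic_inj[OF assms(1)]
  have 1: False if "x \<in> X" "y \<in> X" "x = p y" for x y
    using assms(2)[OF that(1)] assms(2)[OF that(2)] cube[of y] that(3) by (simp add: cycle_min_def)
  have 2: False if "x \<in> X" "y \<in> X" "x = p (p y)" for x y
    using assms(2)[OF that(1)] assms(2)[OF that(2)] cube[of y] that(3) by (simp add: cycle_min_def)
  show "X \<inter> p ` X = {}" using 1 by blast
  show "X \<inter> (\<lambda>x. p (p x)) ` X = {}" using 2 by blast
  show "p ` X \<inter> (\<lambda>x. p (p x)) ` X = {}" using 1 inj by blast
  show "card (p ` X) = card X" using inj by (intro card_image) (simp add: inj_on_def)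
  show "card ((\<lambda>x. p (p x)) ` X) = card X" using inj by (intro card_image) (simp add: inj_on_def)
qed

lemma card_cycle_minima:
  assumes "three_cyclic (3 * n) p"
  shows "card {x. cycle_min p x} = n"
proof -
  let ?X = "{x. cycle_min p x}"
  have sub: "?X \<subseteq> {1..3 * n}"
  proof
    fix x assume "x \<in> ?X"
    then have "p x \<noteq> x" by (simp add: cycle_min_def)
    then show "x \<in> {1..3 * n}" by (rule three_cyclic_moved[OF assms])
  qed
  then have fin: "finite ?X" using finite_subset by blast
  have "{1..3 * n} = ?X \<union> p ` ?X \<union> (\<lambda>x. p (p x)) ` ?X"
  proof
    show "{1..3 * n} \<subseteq> ?X \<union> p ` ?X \<union> (\<lambda>x. p (p x)) ` ?X"
      using cycle_min_exists[OF assms] by blast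
    show "?X \<union> p ` ?X \<union> (\<lambda>x. p (p x)) ` ?X \<subseteq> {1..3 * n}"
      using sub three_cyclic_facts(5,6)[OF assms] by blast
  qed
  then have "3 * n = card (?X \<union> p ` ?X \<union> (\<lambda>x. p (p x)) ` ?X)" by (metis card_atLeastAtMost diff_Suc_1)
  also have "\<dots> = 3 * card ?X"
  proof -
    note d = cycles_of_minima[OF assms _ fin, simplified]
    have "card (?X \<union> p ` ?X \<union> (\<lambda>x. p (p x)) ` ?X) = card (?X \<union> p ` ?X) + card ((\<lambda>x. p (p x)) ` ?X)"
      by (rule card_Un_disjoint) (use fin d in auto)
    also have "card (?X \<union> p ` ?X) = card ?X + card (p ` ?X)"
      by (rule card_Un_disjoint) (use fin d in auto)
    finally show ?thesis using d(4,5) by simp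
  qed
  finally show ?thesis by simp
qed

text \<open>Minima are closed downwards: if y lies before a minimum x, then
  \<open>y < x < p y\<close> by \<open>before_cycle_min\<close>. If y were not minimal, then
  \<open>p (p y) < y < p y\<close> would make \<open>p (p y)\<close> the minimum of a cycle of form
  231.\<close>

lemma pure_312_minima:
  assumes "three_cyclic (3 * n) p" "no132 p" "\<And>x. \<not> has_231_cycle_at p x"
  shows "{x. cycle_min p x} = {1..n}"
proof (rule initial_segmentI)
  have sub: "{x. cycle_min p x} \<subseteq> {1..3 * n}"
  proof
    fix x assume "x \<in> {x. cycle_min p x}"
    then have "p x \<noteq> x" by (simp add: cycle_min_def)
    then show "x \<in> {1..3 * n}" by (rule three_cyclic_moved[OF assms(1)])
  qed
  then show "{x. cycle_min p x} \<subseteq> {1..}" by auto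
  show "finite {x. cycle_min p x}" using sub finite_subset by blast
  show "card {x. cycle_min p x} = n" by (rule card_cycle_minima[OF assms(1)])
  fix x y assume xy: "x \<in> {x. cycle_min p x}" "1 \<le> y" "y < x"
  then have "x < p y" using before_cycle_min[OF assms(1,2)] by simp
  then have "y < p y" using xy by simp
  moreover have "y < p (p y)"
  proof (rule ccontr)
    assume "\<not> y < p (p y)"
    then have "p (p y) \<noteq> y \<Longrightarrow> has_231_cycle_at p (p (p y))"
      using \<open>y < p y\<close> three_cyclic_cube[OF assms(1), of y] by (simp add: has_231_cycle_at_def)
    moreover have "p (p y) \<noteq> y"
      using three_cyclic_facts(2)[OF assms(1), of y] three_cyclic_moved[OF assms(1), of y] \<open>y < p y\<close> by simp
    ultimately show False using assms(3) by blast
  qed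
  ultimately show "y \<in> {x. cycle_min p x}" by (simp add: cycle_min_def)
qed

lemma pure_312_above:
  assumes "three_cyclic (3 * n) p" "no132 p" "\<And>x. \<not> has_231_cycle_at p x" "1 \<le> x" "x \<le> n"
  shows "n < p x" "n < p (p x)" "p (p x) < p x"
proof -
  note mins = pure_312_minima[OF assms(1-3)]
  have mx: "cycle_min p x" and mn: "cycle_min p n" using mins assms(4,5) by auto
  show *: "n < p x"
    using before_cycle_min[OF assms(1,2) mn assms(4)] assms(5) mx by (cases "x = n") (auto simp: cycle_min_def)
  have "\<not> cycle_min p (p (p x))" 
    using mx three_cyclic_cube[OF assms(1), of x] by (simp add: cycle_min_def)
  then have "p (p x) \<notin> {1..n}" using mins by blast
  moreover have "1 \<le> p (p x)" using mx by (simp add: cycle_min_def)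
  ultimately show "n < p (p x)" by simp
  have "x \<in> {1..3 * n}" using assms by simp
  then show "p (p x) < p x"
    using assms(3)[of x] mx three_cyclic_facts(3)[OF assms(1)] by (simp add: has_231_cycle_at_def cycle_min_def)
      (metis linorder_neqE_nat)
qed

text \<open>Within \<open>{1..3 * n}\<close>, the positions above n with values above n are the
  largest elements of their cycles, so there \<open>p x < x\<close> and \<open>p (p x) <= n\<close>.
  If \<open>p z < p y\<close>, then \<open>p z < p y < y < z\<close>, and positions
  \<open>p z\<close>, y, z carry the 132 pattern \<open>p (p z)\<close>, \<open>p y\<close>,
  \<open>p z\<close>. Fixed points beyond 3n are covered too, as \<open>no132\<close> ranges over
  them.\<close>

lemma pure_312_increasing:
  assumes "three_cyclic (3 * n) p" "no132 p" "\<And>x. \<not> has_231_cycle_at p x"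
    and "n < y" "y < z" "n < p y" "n < p z"
  shows "p y < p z"
proof (cases "z \<le> 3 * n")
  case False
  then have "p z = z" using three_cyclic_outside[OF assms(1)] by simp
  moreover have "p y \<le> z"
  proof (cases "y \<in> {1..3 * n}")
    case True
    then have "p y \<in> {1..3 * n}" by (rule three_cyclic_facts(5)[OF assms(1)])
    then show ?thesis using False by simp
  next
    case False
    then show ?thesis using three_cyclic_outside[OF assms(1)] assms(5) by simp
  qed
  moreover have "p y \<noteq> p z" using three_cyclic_inj[OF assms(1)] assms(5) by simp
  ultimately show ?thesis by simp
next
  case True
  note mins = pure_312_minima[OF assms(1-3)]
  have cyc: "p (p x) \<in> {1..n} \<and> p x < x" if "x \<in> {1..3 * n}" "n < x" "n < p x" for x
  proof -
    from cycle_min_exists[OF assms(1) that(1)]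
    obtain a where a: "cycle_min p a" "x = a \<or> x = p a \<or> x = p (p a)" by blast
    then have an: "1 \<le> a" "a \<le> n" using mins by auto
    have "x = p a" using a(2) an that three_cyclic_cube[OF assms(1), of a] by auto
    then show ?thesis using an pure_312_above(3)[OF assms(1-3) an] three_cyclic_cube[OF assms(1), of a] by simp
  qed
  have z: "p (p z) \<in> {1..n}" "p z < z" using cyc[of z] True assms by auto
  have y: "p (p y) \<in> {1..n}" "p y < y" using cyc[of y] True assms by auto
  have ne: "p y \<noteq> p z" using three_cyclic_inj[OF assms(1)] assms(5) by simp
  show ?thesis
  proof (rule ccontr)
    assume "\<not> p y < p z"
    then have "p z < p y" using ne by simp
    then show False
      using no132D[OF assms(2), of "p z" y z] y z assms(4-7) by simp
  qed
qed

section \<open>Removing the outer cycles of form 312\<close>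

text \<open>The order embedding that skips \<open>{k + 1..k + t}\<close>. Since it preserves and
  reflects the order, patterns and cycle forms of the outer permutation survive unchanged.\<close>

definition lift_around :: "nat \<Rightarrow> nat \<Rightarrow> nat \<Rightarrow> nat" where
  "lift_around k t x = (if x \<le> k then x else x + t)"

text \<open>r is inserted as a block of size t into s, after position k and above value k.\<close>

definition inflate :: "nat \<Rightarrow> nat \<Rightarrow> (nat \<Rightarrow> nat) \<Rightarrow> (nat \<Rightarrow> nat) \<Rightarrow> nat \<Rightarrow> nat" where
  "inflate k t s r x = (if x \<le> k then lift_around k t (s x)
     else if x \<le> k + t then k + r (x - k) else lift_around k t (s (x - t)))"

lemma lift_around_less_iff: "lift_around k t x < lift_around k t y \<longleftrightarrow> x < y"
  by (auto simp: lift_around_def)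

lemma lift_around_eq_iff: "lift_around k t x = lift_around k t y \<longleftrightarrow> x = y"
  by (auto simp: lift_around_def)

lemma lift_around_cases:
  obtains y where "x = lift_around k t y" | y where "1 \<le> y" "y \<le> t" "x = k + y"
proof -
  consider "x \<le> k" | "k < x" "x \<le> k + t" | "k + t < x" by linarith
  then show ?thesis
  proof cases
    case 1 then show ?thesis using that(1)[of x] by (simp add: lift_around_def)
  next
    case 2 then show ?thesis using that(2)[of "x - k"] by simp
  next
    case 3 then show ?thesis using that(1)[of "x - t"] by (simp add: lift_around_def)
  qed
qed

lemma inflate_outer: "inflate k t s r (lift_around k t x) = lift_around k t (s x)"
  by (simp add: inflate_def lift_around_def)

lemma inflate_inner: "1 \<le> x \<Longrightarrow> x \<le> t \<Longrightarrow> inflate k t s r (k + x) = k + r x"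
  by (simp add: inflate_def)

lemma three_cyclic_inflate:
  assumes "three_cyclic (3 * k) s" "three_cyclic t r"
  shows "three_cyclic (3 * k + t) (inflate k t s r)"
proof (rule three_cyclicI)
  fix x assume x: "x \<notin> {1..3 * k + t}"
  show "inflate k t s r x = x"
  proof (cases rule: lift_around_cases[of x k t])
    case (1 y)
    then have "y \<notin> {1..3 * k}" using x by (auto simp: lift_around_def split: if_splits)
    then have "s y = y" by (rule three_cyclic_outside[OF assms(1)])
    then show ?thesis unfolding 1 inflate_outer by simp
  qed (use x in auto)
next
  fix x assume x: "x \<in> {1..3 * k + t}"
  show "inflate k t s r x \<noteq> x"
  proof (cases rule: lift_around_cases[of x k t])
    case (1 y)
    then have "y \<in> {1..3 * k}" using x by (auto simp: lift_around_def split: if_splits)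
    then have "s y \<noteq> y" by (rule three_cyclic_facts(1)[OF assms(1)])
    then show ?thesis unfolding 1 inflate_outer lift_around_eq_iff .
  next
    case (2 y)
    then have "r y \<noteq> y" by (intro three_cyclic_facts(1)[OF assms(2)]) simp
    then show ?thesis using 2 inflate_inner[of y t k s r] by simp
  qed
next
  fix x
  show "inflate k t s r (inflate k t s r (inflate k t s r x)) = x"
  proof (cases rule: lift_around_cases[of x k t])
    case (1 y)
    then show ?thesis by (simp add: inflate_outer three_cyclic_cube[OF assms(1)])
  next
    case (2 y)
    have "y \<in> {1..t}" using 2 by simp
    note f = three_cyclic_facts(5,6)[OF assms(2) this]
    show ?thesis using 2 f by (simp add: inflate_inner three_cyclic_cube[OF assms(2)])
  qed
qed

text \<open>A pattern cannot mix outer and inner entries. If it starts at one of the first k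
  positions, its first value exceeds k + t, so no inner value can follow. If it starts inside the
  block and ends outside, its other two positions lie to the right of the block with values above
  it, where s increases by \<open>pure_312_increasing\<close>. So it lies entirely in s or entirely
  in r.\<close>

lemma no132_inflate:
  assumes s: "three_cyclic (3 * k) s" "no132 s" "\<And>x. \<not> has_231_cycle_at s x"
    and r: "three_cyclic t r" "no132 r"
  shows "no132 (inflate k t s r)"
  unfolding no132_def
proof (intro allI impI notI)
  fix i j l :: nat
  let ?p = "inflate k t s r" and ?u = "lift_around k t"
  assume ijl: "1 \<le> i" "i < j" "j < l" "?p i < ?p l \<and> ?p l < ?p j"
  have inner: "k < ?p x \<and> ?p x \<le> k + t" if "k < x" "x \<le> k + t" for x
  proof -
    have "x - k \<in> {1..t}" using that by auto
    then have "r (x - k) \<in> {1..t}" by (rule three_cyclic_facts(5)[OF r(1)])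
    then show ?thesis using that inflate_inner[of "x - k" t k s r] by simp
  qed
  have left: "k + t < ?p x" if "1 \<le> x" "x \<le> k" for x
    using pure_312_above(1)[OF s that] that by (simp add: inflate_def lift_around_def)
  have outer: "\<exists>y. x = ?u y" if "x \<le> k \<or> k + t < x" for x
    using that by (cases rule: lift_around_cases[of x k t]) auto
  have outer_out: "?p x \<le> k \<or> k + t < ?p x" if "x \<le> k \<or> k + t < x" for x
  proof -
    obtain y where y: "x = ?u y" using outer[OF \<open>x \<le> k \<or> k + t < x\<close>] by blast
    show ?thesis unfolding y inflate_outer by (simp add: lift_around_def)
  qed
  have all_outer: False if "i \<le> k \<or> k + t < i" "j \<le> k \<or> k + t < j" "l \<le> k \<or> k + t < l"
  proof -
    from outer[OF that(1)] outer[OF that(2)] outer[OF that(3)]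
    obtain i' j' l' where e: "i = ?u i'" "j = ?u j'" "l = ?u l'" by blast
    have "1 \<le> i'" using ijl(1) e(1) by (auto simp: lift_around_def split: if_splits)
    then show False
      using no132D[OF s(2), of i' j' l'] ijl unfolding e inflate_outer lift_around_less_iff by blast
  qed
  consider "i \<le> k" | "k < i" "i \<le> k + t" | "k + t < i" by linarith
  then show False
  proof cases
    case 1
    then have "k + t < ?p i" using left ijl(1) by simp
    then have "k + t < ?p j" "k + t < ?p l" using ijl(4) by linarith+
    then have "j \<le> k \<or> k + t < j" "l \<le> k \<or> k + t < l" using inner[of j] inner[of l] by linarith+
    then show False using all_outer 1 by blast
  next
    case 2
    show False
    proof (cases "l \<le> k + t")
      case True
      have "?p i = k + r (i - k)" "?p j = k + r (j - k)" "?p l = k + r (l - k)"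
        using inflate_inner[of "i - k" t k s r] inflate_inner[of "j - k" t k s r]
          inflate_inner[of "l - k" t k s r] 2 ijl True by simp_all
      moreover have "1 \<le> i - k" "i - k < j - k" "j - k < l - k" using 2 ijl by linarith+
      ultimately show False
        using no132D[OF r(2), of "i - k" "j - k" "l - k"] ijl(4) by simp
    next
      case False
      have "k < ?p i" using inner[of i] 2 by simp
      then have "k + t < ?p l" using outer_out[of l] False ijl(4) by linarith
      then have "k + t < j" using inner[of j] ijl 2 by linarith
      define j' l' where "j' = j - t" and "l' = l - t"
      have jl: "j = ?u j'" "l = ?u l'" "k < j'" "j' < l'"
        using \<open>k + t < j\<close> ijl(3) by (auto simp: j'_def l'_def lift_around_def)
      have "k < s l'" "k < s j'"
        using \<open>k + t < ?p l\<close> ijl(4) unfolding jl(1,2) inflate_outer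
        by (auto simp: lift_around_def split: if_splits)
      from pure_312_increasing[OF s jl(3,4) this(2,1)]
      show False using ijl(4) unfolding jl(1,2) inflate_outer lift_around_less_iff by simp
    qed
  next
    case 3
    then show False using all_outer ijl by simp
  qed
qed

lemma inflate_inject:
  assumes "inflate k t s r = inflate k t s' r'" "three_cyclic t r" "three_cyclic t r'"
  shows "s = s' \<and> r = r'"
proof
  show "s = s'"
  proof
    fix x
    have "lift_around k t (s x) = lift_around k t (s' x)"
      using fun_cong[OF assms(1), of "lift_around k t x"] unfolding inflate_outer .
    then show "s x = s' x" unfolding lift_around_eq_iff .
  qed
  show "r = r'"
  proof
    fix x
    show "r x = r' x"
    proof (cases "x \<in> {1..t}")
      case True
      then show ?thesis using fun_cong[OF assms(1), of "k + x"] by (simp add: inflate_inner)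
    next
      case False
      then show ?thesis using three_cyclic_outside assms(2,3) by metis
    qed
  qed
qed

text \<open>The positions 1, ..., k turn out to be the minima of the 312 cycles preceding the first
  cycle of form 231, so k counts the outer cycles.\<close>

definition first_231 :: "nat \<Rightarrow> nat \<Rightarrow> (nat \<Rightarrow> nat) set" where
  "first_231 m k = {p \<in> V312 m. has_231_cycle_at p (k + 1) \<and> (\<forall>x\<le>k. \<not> has_231_cycle_at p x)}"

lemma inflate_in_first_231:
  assumes "1 \<le> k" "s \<in> A_set (3 * k)" "r \<in> V231 t" "t \<noteq> 0"
  shows "inflate k t s r \<in> first_231 (3 * k + t) k"
proof -
  have s: "three_cyclic (3 * k) s" "no132 s" "\<And>x. \<not> has_231_cycle_at s x"
    using assms(2) A_set_iff by blast+
  have r: "three_cyclic t r" "no132 r" "r 1 < r (r 1)"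
    using assms(3) by (auto simp: V231_def)
  let ?p = "inflate k t s r"
  have low: "?p x = lift_around k t (s x)" "?p (?p x) = lift_around k t (s (s x))" if "x \<le> k" for x
    using that inflate_outer[of k t s r x] inflate_outer[of k t s r "s x"] by (simp_all add: lift_around_def)
  have "?p (?p 1) < ?p 1"
    using pure_312_above(3)[OF s, of 1] assms(1) low[of 1] by (simp add: lift_around_less_iff)
  moreover have "has_231_cycle_at ?p (k + 1)"
  proof -
    have "1 \<in> {1..t}" using assms(4) by simp
    note f = three_cyclic_facts[OF r(1) this]
    have "?p (k + 1) = k + r 1" by (rule inflate_inner) (use assms(4) in auto)
    moreover have "?p (k + r 1) = k + r (r 1)" by (rule inflate_inner) (use f in auto)
    ultimately show ?thesis using f r(3) by (auto simp: has_231_cycle_at_def)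
  qed
  moreover have "\<not> has_231_cycle_at ?p x" if "x \<le> k" for x
  proof
    assume "has_231_cycle_at ?p x"
    then have a: "x < ?p x" "?p x < ?p (?p x)" by (simp_all add: has_231_cycle_at_def)
    have xl: "lift_around k t x = x" using that by (simp add: lift_around_def)
    have "lift_around k t x < lift_around k t (s x)"
      unfolding xl using a(1) unfolding low(1)[OF that] .
    moreover have "lift_around k t (s x) < lift_around k t (s (s x))"
      using a(2) unfolding low(2)[OF that] unfolding low(1)[OF that] .
    ultimately have "has_231_cycle_at s x"
      unfolding has_231_cycle_at_def lift_around_less_iff by blast
    then show False using s(3) by blast
  qed
  ultimately show ?thesis
    using three_cyclic_inflate[OF s(1) r(1)] no132_inflate[OF s r(1,2)]
    by (simp add: first_231_def V312_def)
qed

text \<open>Positions 1, ..., k are minima of 312 cycles; \<open>U\<close> collects the other 2k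
  points of these cycles and \<open>L\<close> the remaining points above k. Nesting puts all of
  \<open>U\<close> above all of \<open>L\<close>, so by size \<open>L\<close> is the interval
  following k. It is mapped to itself, hence p restricts to a block \<open>r\<close> on it and to
  \<open>s\<close> around it.\<close>

lemma first_231_decompose:
  assumes p: "p \<in> first_231 m k"
  obtains s r where "1 \<le> k" "3 * k < m" "s \<in> A_set (3 * k)" "r \<in> V231 (m - 3 * k)"
    "p = inflate k (m - 3 * k) s r"
proof -
  have tc: "three_cyclic m p" and no: "no132 p" and p1: "p (p 1) < p 1"
    and at: "has_231_cycle_at p (k + 1)" and least: "\<And>x. x \<le> k \<Longrightarrow> \<not> has_231_cycle_at p x"
    using p by (auto simp: first_231_def V312_def)
  note cube = three_cyclic_cube[OF tc] and inj = three_cyclic_inj[OF tc]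
  define t where "t = m - 3 * k"
  have k1: "1 \<le> k"
  proof (rule ccontr)
    assume "\<not> 1 \<le> k"
    then have "k = 0" by simp
    then have "has_231_cycle_at p 1" using at by simp
    then show False using p1 by (simp add: has_231_cycle_at_def)
  qed
  \<comment> \<open>By \<open>before_cycle_min\<close> at k + 1, j is mapped upwards. A point
    \<open>p (p j)\<close> below j would be the minimum of a 231 cycle before k + 1.\<close>
  have early: "cycle_min p j \<and> p (p j) < p j" if "1 \<le> j" "j \<le> k" for j
  proof -
    have "k + 1 < p j"
      using before_cycle_min[OF tc no has_231_imp_cycle_min[OF at] that(1)] that(2) by simp
    then have j: "j < p j" using that by simp
    have range: "j \<in> {1..m}" using three_cyclic_moved[OF tc] j by simp
    note f = three_cyclic_facts[OF tc range]
    have "j < p (p j)"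
    proof (rule ccontr)
      assume "\<not> j < p (p j)"
      then have "p (p j) < j" using f(2) by simp
      then have "has_231_cycle_at p (p (p j))" using j f(4) by (simp add: has_231_cycle_at_def)
      then show False using least[of "p (p j)"] \<open>p (p j) < j\<close> that by simp
    qed
    moreover have "p (p j) < p j"
      using least[of j] that(2) j f(3) by (simp add: has_231_cycle_at_def)
    ultimately show ?thesis using j by (simp add: cycle_min_def)
  qed
  define U where "U = p ` {1..k} \<union> (\<lambda>x. p (p x)) ` {1..k}"
  define L where "L = {k + 1..<k + 1 + (m - k)} - U"
  have km: "k + 1 \<in> {1..m}"
    using at by (intro three_cyclic_moved[OF tc]) (simp add: has_231_cycle_at_def)
  have min: "cycle_min p x" if "x \<in> {1..k}" for x using early that by simp
  note disj = cycles_of_minima[OF tc min finite_atLeastAtMost]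
  have cardU: "card U = 2 * k"
    unfolding U_def using disj(3,4,5) by (subst card_Un_disjoint) auto
  have "x \<in> {k + 1..<k + 1 + (m - k)}" if "x \<in> U" for x
  proof -
    have sub: "{1..k} \<subseteq> {1..m}" using km by auto
    have "x \<in> {1..m}" using that three_cyclic_facts(5,6)[OF tc] sub unfolding U_def by blast
    moreover have "x \<notin> {1..k}" using disj(1,2) that unfolding U_def by blast
    ultimately show ?thesis by auto
  qed
  then have UL: "U \<union> L = {k + 1..<k + 1 + (m - k)}" unfolding L_def by blast
  have closed: "p x \<in> L" if "x \<in> L" for x
  proof -
    have x: "x \<in> {1..m}" "x \<notin> {1..k}" "x \<notin> U" using that by (auto simp: L_def)
    have "p x \<in> {1..m}" by (rule three_cyclic_facts(5)[OF tc x(1)])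
    moreover have "p x \<notin> {1..k}"
    proof
      assume "p x \<in> {1..k}"
      then have "p (p (p x)) \<in> U" unfolding U_def by blast
      then show False using x(3) by (simp add: cube)
    qed
    moreover have "p x \<notin> U"
    proof
      assume "p x \<in> U"
      then obtain j where j: "j \<in> {1..k}" "p x = p j \<or> p x = p (p j)" unfolding U_def by blast
      then have "x = j \<or> x = p j" by (simp add: inj)
      then show False using j(1) x(2,3) unfolding U_def by blast
    qed
    ultimately show ?thesis using that unfolding L_def by auto
  qed
  \<comment> \<open>A 231 cycle in \<open>L\<close> is bounded directly by the outer cycles. A 312
    cycle in \<open>L\<close> starts after k + 1, so it is first bounded by the 231 cycle at k +
    1.\<close>
  have below: "y < x" if "x \<in> U" "y \<in> L" for x y
  proof -
    have top: "p (p a) < x" if a: "has_231_cycle_at p a" "k < a" for a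
    proof -
      obtain j where j: "1 \<le> j" "j \<le> k" "x = p j \<or> x = p (p j)"
        using \<open>x \<in> U\<close> unfolding U_def by auto
      have "p (p a) < p (p j)"
        using nested_231_in_312[OF tc no _ _ a(1) j(1)] early[OF j(1,2)] j(2) a(2) by simp
      then show ?thesis using j(3) early[OF j(1,2)] by auto
    qed
    have y: "y \<in> {1..m}" using that(2) by (auto simp: L_def)
    obtain a where a: "cycle_min p a" "y = a \<or> y = p a \<or> y = p (p a)"
      using cycle_min_exists[OF tc y] by blast
    have "a \<in> L"
      using a(2) closed[OF that(2)] closed[OF closed[OF that(2)]] that(2) by (auto simp: cube)
    then have ka: "k < a" by (simp add: L_def)
    have ra: "a \<in> {1..m}" using a(1) by (intro three_cyclic_moved[OF tc]) (simp add: cycle_min_def)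
    show ?thesis
    proof (cases "has_231_cycle_at p a")
      case True
      then have "y \<le> p (p a)" using a(2) by (auto simp: has_231_cycle_at_def)
      then show ?thesis using top[OF True ka] by simp
    next
      case False
      then have a312: "p (p a) < p a"
        using a(1) three_cyclic_facts(3)[OF tc ra] by (simp add: has_231_cycle_at_def cycle_min_def)
      have "k + 1 < a" using False at ka by (cases "a = k + 1") auto
      then have "p a < p (k + 1)"
        using nested_312_in_231[OF tc no a(1) a312 at] by simp
      moreover have "y \<le> p a" using a(1,2) a312 by (auto simp: cycle_min_def)
      moreover have "p (k + 1) < p (p (k + 1))" using at by (simp add: has_231_cycle_at_def)
      ultimately show ?thesis using top[OF at] by simp
    qed
  qed
  have split: "U = {k + 1 + (m - k - 2 * k)..<k + 1 + (m - k)}" "L = {k + 1..<k + 1 + (m - k - 2 * k)}"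
    using upper_lower_split[OF UL _ cardU] below by blast+
  have "k + 1 \<in> L"
  proof -
    have "k + 1 \<notin> U"
    proof
      assume "k + 1 \<in> U"
      then obtain j where j: "1 \<le> j" "j \<le> k" "k + 1 = p j \<or> k + 1 = p (p j)"
        unfolding U_def by auto
      have "p (p (k + 1)) < p (p j)"
        using nested_231_in_312[OF tc no _ _ at j(1)] early[OF j(1,2)] j(2) by simp
      then show False using j(3) early[OF j(1,2)] at by (auto simp: has_231_cycle_at_def)
    qed
    then show ?thesis using km by (auto simp: L_def)
  qed
  then have "0 < m - k - 2 * k" using split(2) by simp
  then have m: "3 * k < m" "m = 3 * k + t" by (simp_all add: t_def)
  have U: "U = {k + t + 1..m}" and L: "L = {k + 1..k + t}"
    using split m by auto
  let ?u = "lift_around k t"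
  \<comment> \<open>\<open>d\<close> inverts \<open>lift_around k t\<close> on its image, the
    complement of \<open>L\<close>.\<close>
  define d where "d x = (if x \<le> k then x else x - t)" for x
  define s where "s x = d (p (?u x))" for x
  define r where "r y = (if y \<in> {1..t} then p (k + y) - k else y)" for y
  have us: "?u (s x) = p (?u x)" for x
  proof -
    have "p (?u x) \<notin> L"
    proof
      assume "p (?u x) \<in> L"
      from closed[OF closed[OF this]] have "?u x \<in> L" by (simp add: cube)
      then show False unfolding L by (auto simp: lift_around_def split: if_splits)
    qed
    then show ?thesis unfolding L s_def d_def lift_around_def by auto
  qed
  have kr: "k + r y = p (k + y)" and rr: "r y \<in> {1..t}" if "y \<in> {1..t}" for y
  proof -
    have "p (k + y) \<in> L" using closed[of "k + y"] that by (simp add: L)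
    then show "k + r y = p (k + y)" "r y \<in> {1..t}" using that by (auto simp: r_def L)
  qed
  have pe: "p = inflate k t s r"
  proof
    fix x
    show "p x = inflate k t s r x"
    proof (cases rule: lift_around_cases[of x k t])
      case (1 y)
      then show ?thesis by (simp add: inflate_outer us)
    next
      case (2 y)
      then show ?thesis by (simp add: inflate_inner kr)
    qed
  qed
  have s_tc: "three_cyclic (3 * k) s"
  proof (rule three_cyclicI)
    fix x assume "x \<notin> {1..3 * k}"
    then have "?u x \<notin> {1..m}" using m by (auto simp: lift_around_def)
    then have "?u (s x) = ?u x" using us three_cyclic_outside[OF tc] by simp
    then show "s x = x" by (simp add: lift_around_eq_iff)
  next
    fix x assume "x \<in> {1..3 * k}"
    then have "?u x \<in> {1..m}" using m by (auto simp: lift_around_def)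
    then have "?u (s x) \<noteq> ?u x" using us three_cyclic_facts(1)[OF tc] by simp
    then show "s x \<noteq> x" by auto
  next
    fix x
    have "?u (s (s (s x))) = ?u x" by (simp add: us cube)
    then show "s (s (s x)) = x" by (simp add: lift_around_eq_iff)
  qed
  have s_no: "no132 s"
    unfolding no132_def
  proof (intro allI impI notI)
    fix i j l :: nat assume "1 \<le> i" "i < j" "j < l" "s i < s l \<and> s l < s j"
    then have "1 \<le> ?u i" "?u i < ?u j" "?u j < ?u l" "p (?u i) < p (?u l)" "p (?u l) < p (?u j)"
      unfolding us[symmetric] lift_around_less_iff by (auto simp: lift_around_def)
    then show False by (rule no132D[OF no])
  qed
  \<comment> \<open>A 231 minimum of s lifts to one of p beyond the block, hence in
    \<open>U\<close>. But the cycle of any point of \<open>U\<close> contains a smaller point j from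
    \<open>{1..k}\<close>.\<close>
  have s_pure: "\<not> has_231_cycle_at s x" for x
  proof
    assume "has_231_cycle_at s x"
    then have ux: "has_231_cycle_at p (?u x)"
      unfolding has_231_cycle_at_def us[symmetric] lift_around_less_iff .
    then have "\<not> ?u x \<le> k" using least by blast
    then have big: "k + t < ?u x" "k < ?u x" by (auto simp: lift_around_def split: if_splits)
    have "?u x \<in> {1..m}" using ux by (intro three_cyclic_moved[OF tc]) (simp add: has_231_cycle_at_def)
    then have "?u x \<in> U" using big(1) unfolding U by simp
    then obtain j where j: "j \<in> {1..k}" "?u x = p j \<or> ?u x = p (p j)" unfolding U_def by blast
    then have "p (?u x) = j \<or> p (p (?u x)) = j" by (auto simp: cube)
    then show False using ux big(2) j(1) by (auto simp: has_231_cycle_at_def)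
  qed
  have r_tc: "three_cyclic t r"
  proof (rule three_cyclicI)
    fix x assume "x \<notin> {1..t}"
    then show "r x = x" by (auto simp: r_def)
  next
    fix x assume x: "x \<in> {1..t}"
    then have "p (k + x) \<noteq> k + x" using m by (intro three_cyclic_facts(1)[OF tc]) auto
    then show "r x \<noteq> x" using kr[OF x] by simp
  next
    fix x
    show "r (r (r x)) = x"
    proof (cases "x \<in> {1..t}")
      case True
      have "k + r (r (r x)) = k + x"
        using kr[OF True] kr[OF rr[OF True]] kr[OF rr[OF rr[OF True]]] cube[of "k + x"] by simp
      then show ?thesis by simp
    next
      case False
      then have "r x = x" by (auto simp: r_def)
      then show ?thesis by simp
    qed
  qed
  have r_no: "no132 r"
    unfolding no132_def
  proof (intro allI impI notI)
    fix i j l :: nat assume a: "1 \<le> i" "i < j" "j < l" "r i < r l \<and> r l < r j"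
    have "l \<le> t"
    proof (rule ccontr)
      assume "\<not> l \<le> t"
      then have "r l = l" by (simp add: r_def)
      moreover have "r j \<le> l" using rr[of j] \<open>\<not> l \<le> t\<close> a by (cases "j \<in> {1..t}") (auto simp: r_def)
      ultimately show False using a(4) by simp
    qed
    then have "i \<in> {1..t}" "j \<in> {1..t}" "l \<in> {1..t}" using a by auto
    then show False
      using no132D[OF no, of "k + i" "k + j" "k + l"] a kr[of i] kr[of j] kr[of l] by simp
  qed
  have "r 1 < r (r 1)"
  proof -
    have 1: "1 \<in> {1..t}" using m by simp
    show ?thesis using kr[OF 1] kr[OF rr[OF 1]] at by (simp add: has_231_cycle_at_def)
  qed
  then have "r \<in> V231 t" using r_tc r_no by (simp add: V231_def)
  moreover have "s \<in> A_set (3 * k)" using s_tc s_no s_pure A_set_iff by blast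
  ultimately show thesis using that[of s r] k1 m(1) pe unfolding t_def by blast
qed

text \<open>The coefficient form of V = A (1 + V): sort by the position k + 1 of the first 231
  minimum, if there is one. The central block ranges over \<open>V231\<close>, which is as large as
  \<open>V312\<close>.\<close>

lemma card_V312:
  assumes "1 \<le> n"
  shows "card (V312 (3 * n)) = card (A_set (3 * n)) +
    (\<Sum>k = 1..<n. card (A_set (3 * k)) * card (V312 (3 * (n - k))))"
proof -
  have card_first: "card (first_231 (3 * n) k) = card (A_set (3 * k)) * card (V312 (3 * (n - k)))"
    if k: "1 \<le> k" "k < n" for k
  proof -
    let ?t = "3 * (n - k)"
    have t: "3 * n - 3 * k = ?t" "3 * k + ?t = 3 * n" "?t \<noteq> 0" using k by auto
    have "bij_betw (\<lambda>(s, r). inflate k ?t s r) (A_set (3 * k) \<times> V231 ?t) (first_231 (3 * n) k)"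
      unfolding bij_betw_def
    proof
      show "inj_on (\<lambda>(s, r). inflate k ?t s r) (A_set (3 * k) \<times> V231 ?t)"
      proof (rule inj_onI, clarify)
        fix s r s' r' assume "r \<in> V231 ?t" "r' \<in> V231 ?t" "inflate k ?t s r = inflate k ?t s' r'"
        then show "s = s' \<and> r = r'" using inflate_inject[of k ?t s r s' r'] by (simp add: V231_def)
      qed
      show "(\<lambda>(s, r). inflate k ?t s r) ` (A_set (3 * k) \<times> V231 ?t) = first_231 (3 * n) k"
      proof
        show "(\<lambda>(s, r). inflate k ?t s r) ` (A_set (3 * k) \<times> V231 ?t) \<subseteq> first_231 (3 * n) k"
          using inflate_in_first_231[OF k(1) _ _ t(3)] unfolding t(2) by auto
        show "first_231 (3 * n) k \<subseteq> (\<lambda>(s, r). inflate k ?t s r) ` (A_set (3 * k) \<times> V231 ?t)"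
        proof
          fix p assume "p \<in> first_231 (3 * n) k"
          then obtain s r where "s \<in> A_set (3 * k)" "r \<in> V231 (3 * n - 3 * k)"
            "p = inflate k (3 * n - 3 * k) s r"
            by (rule first_231_decompose)
          then show "p \<in> (\<lambda>(s, r). inflate k ?t s r) ` (A_set (3 * k) \<times> V231 ?t)"
            unfolding t(1) by (rule_tac x = "(s, r)" in image_eqI) simp_all
        qed
      qed
    qed
    from bij_betw_same_card[OF this] show ?thesis
      by (simp add: card_cartesian_product card_V231)
  qed
  have "V312 (3 * n) = A_set (3 * n) \<union> (\<Union>k\<in>{1..<n}. first_231 (3 * n) k)"
  proof
    show "V312 (3 * n) \<subseteq> A_set (3 * n) \<union> (\<Union>k\<in>{1..<n}. first_231 (3 * n) k)"
    proof
      fix p assume p: "p \<in> V312 (3 * n)"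
      show "p \<in> A_set (3 * n) \<union> (\<Union>k\<in>{1..<n}. first_231 (3 * n) k)"
      proof (cases "\<exists>x. has_231_cycle_at p x")
        case False
        then show ?thesis using p by (auto simp: A_set_iff V312_def)
      next
        case True
        define l where "l = (LEAST x. has_231_cycle_at p x)"
        have l: "has_231_cycle_at p l" "\<And>x. x < l \<Longrightarrow> \<not> has_231_cycle_at p x"
          using True LeastI_ex not_less_Least unfolding l_def by metis+
        have tc: "three_cyclic (3 * n) p" using p by (simp add: V312_def)
        have "l \<in> {1..3 * n}"
          using l(1) by (intro three_cyclic_moved[OF tc]) (simp add: has_231_cycle_at_def)
        then have "p \<in> first_231 (3 * n) (l - 1)"
          using p l by (auto simp: first_231_def)
        moreover from this have "1 \<le> l - 1" "3 * (l - 1) < 3 * n"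
          by (auto elim: first_231_decompose)
        ultimately show ?thesis by auto
      qed
    qed
    have "p (p 1) < p 1" if "p \<in> A_set (3 * n)" for p
      using pure_312_above(3)[of n p 1] that assms A_set_iff by blast
    then show "A_set (3 * n) \<union> (\<Union>k\<in>{1..<n}. first_231 (3 * n) k) \<subseteq> V312 (3 * n)"
      by (auto simp: V312_def A_set_iff first_231_def)
  qed
  moreover have "A_set (3 * n) \<inter> (\<Union>k\<in>{1..<n}. first_231 (3 * n) k) = {}"
    by (auto simp: A_set_iff first_231_def)
  moreover have fin: "finite (first_231 (3 * n) k)" for k
    by (rule finite_subset[OF _ finite_V312[of "3 * n"]]) (auto simp: first_231_def)
  moreover have "finite (A_set (3 * n))"
    by (rule finite_subset[OF _ finite_three_cyclic[of "3 * n"]]) (auto simp: A_set_iff)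
  moreover have "card (\<Union>k\<in>{1..<n}. first_231 (3 * n) k) = (\<Sum>k = 1..<n. card (first_231 (3 * n) k))"
  proof (rule card_UN_disjoint)
    show "\<forall>k\<in>{1..<n}. \<forall>k'\<in>{1..<n}. k \<noteq> k' \<longrightarrow> first_231 (3 * n) k \<inter> first_231 (3 * n) k' = {}"
    proof (intro ballI impI)
      fix k k' :: nat assume "k \<noteq> k'"
      then consider "k + 1 \<le> k'" | "k' + 1 \<le> k" by linarith
      then show "first_231 (3 * n) k \<inter> first_231 (3 * n) k' = {}"
        by cases (auto simp: first_231_def)
    qed
  qed (use fin in auto)
  ultimately show ?thesis
    using card_first by (simp add: card_Un_disjoint)
qed

section \<open>Counting 132-avoiding lists\<close>

text \<open>In a list of distinct entries, x is not the 1 of a 132 pattern iff the later entries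
  above x increase.\<close>

fun avoids132 :: "nat list \<Rightarrow> bool" where
  "avoids132 [] = True"
| "avoids132 (x # xs) = (sorted (filter (\<lambda>y. x < y) xs) \<and> avoids132 xs)"

lemma avoids132_iff_nth:
  assumes "distinct xs"
  shows "avoids132 xs \<longleftrightarrow> (\<forall>i j k. i < j \<longrightarrow> j < k \<longrightarrow> k < length xs \<longrightarrow>
           \<not> (xs ! i < xs ! k \<and> xs ! k < xs ! j))"
  using assms
proof (induction xs)
  case (Cons x xs)
  have *: "sorted (filter (\<lambda>y. x < y) xs) \<longleftrightarrow>
     (\<forall>j k. j < k \<longrightarrow> k < length xs \<longrightarrow> \<not> (x < xs ! k \<and> xs ! k < xs ! j))"
  proof -
    have "sorted (filter (\<lambda>y. x < y) ys) \<longleftrightarrow>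
       (\<forall>j k. j < k \<longrightarrow> k < length ys \<longrightarrow> \<not> (x < ys ! k \<and> ys ! k < ys ! j))" for ys
    proof (induction ys)
      case (Cons y ys)
      have "(\<forall>j k. j < k \<longrightarrow> k < length (y # ys) \<longrightarrow> \<not> (x < (y # ys) ! k \<and> (y # ys) ! k < (y # ys) ! j)) \<longleftrightarrow>
        (\<forall>k < length ys. \<not> (x < ys ! k \<and> ys ! k < y)) \<and>
        (\<forall>j k. j < k \<longrightarrow> k < length ys \<longrightarrow> \<not> (x < ys ! k \<and> ys ! k < ys ! j))"
        (is "?L \<longleftrightarrow> ?R")
      proof
        assume L: ?L
        show ?R
        proof (intro conjI allI impI)
          fix k assume "k < length ys"
          then show "\<not> (x < ys ! k \<and> ys ! k < y)" using L[rule_format, of 0 "Suc k"] by simp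
        next
          fix j k assume "j < k" "k < length ys"
          then show "\<not> (x < ys ! k \<and> ys ! k < ys ! j)" using L[rule_format, of "Suc j" "Suc k"] by simp
        qed
      next
        assume R: ?R
        show ?L
        proof (intro allI impI)
          fix j k assume "j < k" "k < length (y # ys)"
          then show "\<not> (x < (y # ys) ! k \<and> (y # ys) ! k < (y # ys) ! j)"
            using R by (cases j; cases k) auto
        qed
      qed
      moreover have "(\<forall>k < length ys. \<not> (x < ys ! k \<and> ys ! k < y)) \<longleftrightarrow>
          (\<forall>z\<in>set ys. x < z \<longrightarrow> y \<le> z)"
        by (auto simp: all_set_conv_all_nth not_less)
      moreover have "\<forall>z\<in>set ys. x < z \<longrightarrow> y \<le> z" if "\<not> x < y"
        using that by auto
      ultimately show ?case using Cons by auto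
    qed simp
    then show ?thesis .
  qed
  have "(\<forall>i j k. i < j \<longrightarrow> j < k \<longrightarrow> k < length (x # xs) \<longrightarrow>
           \<not> ((x # xs) ! i < (x # xs) ! k \<and> (x # xs) ! k < (x # xs) ! j)) \<longleftrightarrow>
        (\<forall>j k. j < k \<longrightarrow> k < length xs \<longrightarrow> \<not> (x < xs ! k \<and> xs ! k < xs ! j)) \<and>
        (\<forall>i j k. i < j \<longrightarrow> j < k \<longrightarrow> k < length xs \<longrightarrow>
           \<not> (xs ! i < xs ! k \<and> xs ! k < xs ! j))" (is "?L \<longleftrightarrow> ?R")
  proof
    assume L: ?L
    show ?R
    proof (intro conjI allI impI)
      fix j k assume "j < k" "k < length xs"
      then show "\<not> (x < xs ! k \<and> xs ! k < xs ! j)" using L[rule_format, of 0 "Suc j" "Suc k"] by simp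
    next
      fix i j k assume "i < j" "j < k" "k < length xs"
      then show "\<not> (xs ! i < xs ! k \<and> xs ! k < xs ! j)"
        using L[rule_format, of "Suc i" "Suc j" "Suc k"] by simp
    qed
  next
    assume R: ?R
    show ?L
    proof (intro allI impI)
      fix i j k assume "i < j" "j < k" "k < length (x # xs)"
      then show "\<not> ((x # xs) ! i < (x # xs) ! k \<and> (x # xs) ! k < (x # xs) ! j)"
        using R by (cases i; cases j; cases k) auto
    qed
  qed
  then show ?case using Cons * by simp
qed simp

text \<open>The last entry of a 132 pattern exceeds its first, so in a skew sum no pattern starts in
  \<open>xs\<close> and ends in \<open>ys\<close>.\<close>

lemma avoids132_append:
  assumes "\<forall>x\<in>set xs. \<forall>y\<in>set ys. y < x"
  shows "avoids132 (xs @ ys) \<longleftrightarrow> avoids132 xs \<and> avoids132 ys"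
  using assms
proof (induction xs)
  case (Cons x xs)
  then have "filter (\<lambda>y. x < y) ys = []" by (auto simp: filter_empty_conv)
  with Cons show ?case by auto
qed simp

text \<open>The maximum M acts as the 3 for every entry before it and every entry after it, which
  forces the skew order of the two sides.\<close>

lemma avoids132_max_split:
  assumes "\<forall>x\<in>set xs \<union> set ys. x < M"
  shows "avoids132 (xs @ M # ys) \<longleftrightarrow>
    avoids132 xs \<and> avoids132 ys \<and> (\<forall>x\<in>set xs. \<forall>y\<in>set ys. y \<le> x)"
  using assms
proof (induction xs)
  case Nil
  then have "filter (\<lambda>y. M < y) ys = []" by (auto simp: filter_empty_conv)
  then show ?case using Nil by simp
next
  case (Cons x xs)
  have "sorted (filter (\<lambda>y. x < y) (xs @ M # ys)) \<longleftrightarrow>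
    sorted (filter (\<lambda>y. x < y) xs) \<and> (\<forall>y\<in>set ys. y \<le> x)"
  proof -
    have M: "x < M" "filter (\<lambda>y. x < y) (xs @ M # ys) = filter (\<lambda>y. x < y) xs @ M # filter (\<lambda>y. x < y) ys"
      using Cons.prems by auto
    show ?thesis
    proof
      assume L: "sorted (filter (\<lambda>y. x < y) (xs @ M # ys))"
      have "y \<le> x" if "y \<in> set ys" for y
      proof (rule ccontr)
        assume "\<not> y \<le> x"
        then have "M \<le> y" using L that unfolding M(2) by (simp add: sorted_append)
        moreover have "y < M" using that Cons.prems by simp
        ultimately show False by simp
      qed
      then show "sorted (filter (\<lambda>y. x < y) xs) \<and> (\<forall>y\<in>set ys. y \<le> x)"
        using L unfolding M(2) by (simp add: sorted_append)
    next
      assume R: "sorted (filter (\<lambda>y. x < y) xs) \<and> (\<forall>y\<in>set ys. y \<le> x)"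
      then have "filter (\<lambda>y. x < y) ys = []" by (simp add: filter_empty_conv not_less)
      then show "sorted (filter (\<lambda>y. x < y) (xs @ M # ys))"
        using R Cons.prems unfolding M(2) by (simp add: sorted_append less_imp_le)
    qed
  qed
  with Cons show ?case by auto
qed

text \<open>The values start at an arbitrary \<open>lo\<close> because the two parts of a skew sum
  occupy different intervals.\<close>

definition avoiders :: "nat \<Rightarrow> nat \<Rightarrow> nat list set" where
  "avoiders lo n = {xs. distinct xs \<and> set xs = {lo..<lo + n} \<and> avoids132 xs}"

lemma avoiders_length: "xs \<in> avoiders lo n \<Longrightarrow> length xs = n"
  unfolding avoiders_def using distinct_card[of xs] by auto

lemma finite_avoiders: "finite (avoiders lo n)"
proof (rule finite_subset)
  show "avoiders lo n \<subseteq> {xs. set xs \<subseteq> {lo..<lo + n} \<and> length xs = n}"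
    using avoiders_length by (auto simp: avoiders_def)
qed (simp add: finite_lists_length_eq)

text \<open>Segner's recurrence; the agreement with the closed formula is
  \<open>catalan_rec_eq\<close>.\<close>

fun catalan_rec :: "nat \<Rightarrow> nat" where
  "catalan_rec 0 = 1"
| "catalan_rec (Suc n) = (\<Sum>i\<le>n. catalan_rec i * catalan_rec (n - i))"

text \<open>Split at the maximum. If i entries precede it, they are the i largest of the others, and
  both sides are arbitrary avoiders of their intervals; \<open>F i\<close> collects these
  lists.\<close>

lemma card_avoiders: "card (avoiders lo n) = catalan_rec n"
proof (induction n arbitrary: lo rule: less_induct)
  case (less n)
  show ?case
  proof (cases n)
    case 0
    then have "avoiders lo n = {[]}" by (auto simp: avoiders_def)
    then show ?thesis using 0 by simp
  next
    case (Suc k)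
    define F where "F i = (\<lambda>(xs, ys). xs @ (lo + k) # ys) ` (avoiders (lo + (k - i)) i \<times> avoiders lo (k - i))" for i
    have inj: "inj_on (\<lambda>(xs, ys). xs @ (lo + k) # ys) (avoiders (lo + (k - i)) i \<times> avoiders lo (k - i))" for i
    proof (rule inj_onI, clarify)
      fix xs ys xs' ys'
      assume "xs \<in> avoiders (lo + (k - i)) i" "xs' \<in> avoiders (lo + (k - i)) i"
        and "xs @ (lo + k) # ys = xs' @ (lo + k) # ys'"
      then show "xs = xs' \<and> ys = ys'" using avoiders_length by (metis append_eq_append_conv list.inject)
    qed
    have cardF: "card (F i) = catalan_rec i * catalan_rec (k - i)" if "i \<le> k" for i
      using less.IH[of i "lo + (k - i)"] less.IH[of "k - i" lo] that
      unfolding F_def card_image[OF inj] card_cartesian_product Suc by simp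
    have finF: "finite (F i)" for i unfolding F_def by (simp add: finite_avoiders)
    have disj: "F i \<inter> F j = {}" if "i \<noteq> j" "i \<le> k" "j \<le> k" for i j
    proof -
      \<comment> \<open>The number of entries before the maximum recovers i from the list, so the
        sets \<open>F i\<close> are disjoint.\<close>
      have "length (takeWhile (\<lambda>x. x \<noteq> lo + k) zs) = i" if "zs \<in> F i" "i \<le> k" for zs i
      proof -
        from that(1) obtain xs ys where zs: "zs = xs @ (lo + k) # ys" "xs \<in> avoiders (lo + (k - i)) i"
          unfolding F_def by (elim imageE SigmaE) simp
        then have "\<forall>x\<in>set xs. x \<noteq> lo + k" using that by (auto simp: avoiders_def)
        then have "takeWhile (\<lambda>x. x \<noteq> lo + k) zs = xs" unfolding zs by (simp add: takeWhile_append2)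
        then show ?thesis using zs avoiders_length by simp
      qed
      note len = this
      show ?thesis
      proof (rule equals0I)
        fix zs assume "zs \<in> F i \<inter> F j"
        then show False using len[of zs i] len[of zs j] that by simp
      qed
    qed
    have "avoiders lo (Suc k) = (\<Union>i\<le>k. F i)"
    proof
      show "avoiders lo (Suc k) \<subseteq> (\<Union>i\<le>k. F i)"
      proof
        fix zs assume zs: "zs \<in> avoiders lo (Suc k)"
        then have "lo + k \<in> set zs" by (auto simp: avoiders_def)
        then obtain xs ys where zs_eq: "zs = xs @ (lo + k) # ys" using split_list by metis
        have d: "distinct xs" "distinct ys" "lo + k \<notin> set xs" "lo + k \<notin> set ys" "set xs \<inter> set ys = {}"
          using zs zs_eq by (auto simp: avoiders_def)
        have "insert (lo + k) (set xs \<union> set ys) = {lo..<lo + Suc k}"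
          using zs zs_eq by (auto simp: avoiders_def)
        then have "set xs \<union> set ys = {lo..<lo + Suc k} - {lo + k}" using d by blast
        also have "\<dots> = {lo..<lo + k}" by auto
        finally have un: "set xs \<union> set ys = {lo..<lo + k}" .
        then have "\<forall>x\<in>set xs \<union> set ys. x < lo + k" by auto
        then have av: "avoids132 xs" "avoids132 ys" "\<forall>x\<in>set xs. \<forall>y\<in>set ys. y \<le> x"
          using zs zs_eq avoids132_max_split by (auto simp: avoiders_def)
        then have "\<forall>x\<in>set xs. \<forall>y\<in>set ys. y < x"
          using d(5) by (auto simp: order.strict_iff_order)
        from upper_lower_split[OF un this distinct_card[OF d(1)]]
        have "set xs = {lo + (k - length xs)..<lo + k}" "set ys = {lo..<lo + (k - length xs)}"
          by blast+
        moreover have "length xs \<le> k"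
          using card_mono[of "{lo..<lo + k}" "set xs"] un distinct_card[OF d(1)] by auto
        ultimately have "xs \<in> avoiders (lo + (k - length xs)) (length xs)" "ys \<in> avoiders lo (k - length xs)"
          unfolding avoiders_def mem_Collect_eq using av d(1,2) by (metis add.assoc le_add_diff_inverse2, metis)
        then have "zs \<in> F (length xs)"
          unfolding F_def zs_eq by (rule_tac x = "(xs, ys)" in image_eqI) simp_all
        then show "zs \<in> (\<Union>i\<le>k. F i)" using \<open>length xs \<le> k\<close> by auto
      qed
    next
      show "(\<Union>i\<le>k. F i) \<subseteq> avoiders lo (Suc k)"
      proof
        fix zs assume "zs \<in> (\<Union>i\<le>k. F i)"
        then obtain i xs ys where i: "i \<le> k" and zs: "zs = xs @ (lo + k) # ys"
          and xs: "xs \<in> avoiders (lo + (k - i)) i" and ys: "ys \<in> avoiders lo (k - i)"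
          unfolding F_def by (elim UN_E imageE SigmaE) simp
        have s: "set xs = {lo + (k - i)..<lo + k}" "set ys = {lo..<lo + (k - i)}"
          using xs ys i by (auto simp: avoiders_def)
        have "avoids132 zs" unfolding zs
          using xs ys s i by (subst avoids132_max_split) (auto simp: avoiders_def)
        moreover have "distinct zs" using xs ys s i zs by (auto simp: avoiders_def)
        moreover have "set zs = {lo..<lo + Suc k}" using s i zs by auto
        ultimately show "zs \<in> avoiders lo (Suc k)" by (simp add: avoiders_def)
      qed
    qed
    then have "card (avoiders lo (Suc k)) = (\<Sum>i\<le>k. card (F i))"
      using finF disj by (simp add: card_UN_disjoint)
    then show ?thesis using Suc cardF by simp
  qed
qed

section \<open>Dyck paths with a compatible 132-avoiding list\<close>

text \<open>Letter t of a word describes the gap between the indices t and t + 1: whether the up steps and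
  whether the down steps of a Dyck path are interrupted there.\<close>

definition respects_cuts :: "(bool \<times> bool) list \<Rightarrow> nat list \<Rightarrow> bool" where
  "respects_cuts L r \<longleftrightarrow> (\<forall>t<length L. L ! t \<noteq> (False, False) \<longrightarrow>
     (\<forall>i\<le>t. \<forall>l. t < l \<longrightarrow> l < length r \<longrightarrow> r ! l < r ! i))"

text \<open>k is the size of the block still being read. Every letter other than
  \<open>(False, False)\<close> closes it, so the weight is the product of the Catalan numbers of
  the block sizes.\<close>

fun block_weight :: "nat \<Rightarrow> (bool \<times> bool) list \<Rightarrow> nat" where
  "block_weight k [] = catalan_rec k"
| "block_weight k (x # L) =
     (if x = (False, False) then block_weight (Suc k) L else catalan_rec k * block_weight 1 L)"

text \<open>k uncut gaps lie inside a block \<open>a\<close> of k + 1 entries, and x is the cut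
  right after it. That cut puts all of \<open>a\<close> above all of \<open>b\<close>, which already
  gives what later cuts demand of pairs starting in \<open>a\<close>.\<close>

lemma respects_cuts_append:
  assumes "length a = Suc k" "x \<noteq> (False, False)" "length b = Suc (length L)"
  shows "respects_cuts (replicate k (False, False) @ x # L) (a @ b) \<longleftrightarrow>
    (\<forall>u\<in>set a. \<forall>v\<in>set b. v < u) \<and> respects_cuts L b" (is "?l \<longleftrightarrow> ?r")
proof
  let ?L = "replicate k (False, False) @ x # L"
  assume l: ?l
  show ?r
  proof
    show "\<forall>u\<in>set a. \<forall>v\<in>set b. v < u"
    proof (intro ballI)
      fix u v assume "u \<in> set a" "v \<in> set b"
      then obtain i j where ij: "i < length a" "u = a ! i" "j < length b" "v = b ! j"
        by (auto simp: in_set_conv_nth)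
      have "(a @ b) ! (Suc k + j) < (a @ b) ! i"
        using l[unfolded respects_cuts_def, rule_format, of k i "Suc k + j"] ij assms
        by (simp add: nth_append)
      then show "v < u" using ij assms by (simp add: nth_append)
    qed
    show "respects_cuts L b" unfolding respects_cuts_def
    proof (intro allI impI)
      fix t i j assume H: "t < length L" "L ! t \<noteq> (False, False)" "i \<le> t" "t < j" "j < length b"
      have "(a @ b) ! (Suc k + j) < (a @ b) ! (Suc k + i)"
        using l[unfolded respects_cuts_def, rule_format, of "Suc k + t" "Suc k + i" "Suc k + j"] H assms
        by (simp add: nth_append)
      then show "b ! j < b ! i" using assms by (simp add: nth_append)
    qed
  qed
next
  let ?L = "replicate k (False, False) @ x # L"
  assume r: ?r
  show ?l unfolding respects_cuts_def
  proof (intro allI impI)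
    fix t i j assume H: "t < length ?L" "?L ! t \<noteq> (False, False)" "i \<le> t" "t < j" "j < length (a @ b)"
    have "k \<le> t" using H(2) by (auto simp: nth_append split: if_splits)
    then have j: "(a @ b) ! j = b ! (j - Suc k)" "j - Suc k < length b"
      using H assms by (auto simp: nth_append)
    show "(a @ b) ! j < (a @ b) ! i"
    proof (cases "i < Suc k")
      case True
      then have "a ! i \<in> set a" "(a @ b) ! i = a ! i" using assms by (auto simp: nth_append)
      then show ?thesis using r j by simp
    next
      case False
      then have i: "(a @ b) ! i = b ! (i - Suc k)" using assms by (auto simp: nth_append)
      have "?L ! t = L ! (t - Suc k)" using False H by (auto simp: nth_append nth_Cons')
      then show ?thesis unfolding i j(1)
        using r[THEN conjunct2, unfolded respects_cuts_def, rule_format, of "t - Suc k" "i - Suc k" "j - Suc k"]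
          H j(2) False by auto
    qed
  qed
qed

lemma avoiders_append_iff:
  assumes "length a = i" "length b = j" "\<forall>u\<in>set a. \<forall>v\<in>set b. v < u"
  shows "a @ b \<in> avoiders lo (i + j) \<longleftrightarrow> a \<in> avoiders (lo + j) i \<and> b \<in> avoiders lo j"
proof
  assume ab: "a @ b \<in> avoiders lo (i + j)"
  then have d: "distinct a" "distinct b" and un: "set a \<union> set b = {lo..<lo + (i + j)}"
    and av: "avoids132 a" "avoids132 b"
    using avoids132_append[OF assms(3)] by (auto simp: avoiders_def)
  have "card (set a) = i" using distinct_card[OF d(1)] assms(1) by simp
  from upper_lower_split[OF un assms(3) this]
  show "a \<in> avoiders (lo + j) i \<and> b \<in> avoiders lo j"
    using d av by (simp add: avoiders_def ac_simps)
next
  assume "a \<in> avoiders (lo + j) i \<and> b \<in> avoiders lo j"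
  then show "a @ b \<in> avoiders lo (i + j)"
    using avoids132_append[OF assms(3)] by (auto simp: avoiders_def)
qed

text \<open>The uncut prefix is the generalisation needed for the induction: it is the open block,
  as in \<open>block_weight\<close>. At a cut, r splits into an arbitrary avoider of the closed
  block and a list respecting the remaining cuts.\<close>

lemma card_respects_cuts:
  "card {r \<in> avoiders lo (Suc k + length L). respects_cuts (replicate k (False, False) @ L) r} =
     block_weight (Suc k) L"
proof (induction L arbitrary: k lo)
  case Nil
  have "respects_cuts (replicate k (False, False)) r" for r
    by (simp add: respects_cuts_def)
  then show ?case by (simp add: card_avoiders del: catalan_rec.simps)
next
  case (Cons x L)
  show ?case
  proof (cases "x = (False, False)")
    case True
    have "replicate k (False, False) @ x # L = replicate (Suc k) (False, False) @ L"
      by (simp add: True replicate_app_Cons_same)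
    moreover have "Suc k + length (x # L) = Suc (Suc k) + length L" by simp
    ultimately show ?thesis using Cons.IH[of lo "Suc k"] True
      by (simp only: block_weight.simps simp_thms if_True)
  next
    case False
    let ?j = "Suc (length L)"
    let ?B = "{r \<in> avoiders lo ?j. respects_cuts L r}"
    let ?X = "{r \<in> avoiders lo (Suc k + ?j). respects_cuts (replicate k (False, False) @ x # L) r}"
    have "bij_betw (\<lambda>(a, b). a @ b) (avoiders (lo + ?j) (Suc k) \<times> ?B) ?X"
    proof (rule bij_betwI[where g = "\<lambda>r. (take (Suc k) r, drop (Suc k) r)"])
      show "(\<lambda>(a, b). a @ b) \<in> avoiders (lo + ?j) (Suc k) \<times> ?B \<rightarrow> ?X"
      proof (clarify)
        fix a b assume a: "a \<in> avoiders (lo + ?j) (Suc k)" and b: "b \<in> avoiders lo ?j" "respects_cuts L b"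
        have len: "length a = Suc k" "length b = ?j" using a b avoiders_length by auto
        have "\<forall>u\<in>set a. \<forall>v\<in>set b. v < u" using a b by (auto simp: avoiders_def)
        then show "a @ b \<in> avoiders lo (Suc k + ?j) \<and> respects_cuts (replicate k (False, False) @ x # L) (a @ b)"
          using respects_cuts_append[OF len(1) False len(2)] avoiders_append_iff[OF len] a b by blast
      qed
      show "(\<lambda>r. (take (Suc k) r, drop (Suc k) r)) \<in> ?X \<rightarrow> avoiders (lo + ?j) (Suc k) \<times> ?B"
      proof
        fix r assume r: "r \<in> ?X"
        then have "length r = Suc k + ?j" using avoiders_length by blast
        then have len: "length (take (Suc k) r) = Suc k" "length (drop (Suc k) r) = ?j" by simp_all
        have "take (Suc k) r @ drop (Suc k) r \<in> avoiders lo (Suc k + ?j)"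
          "respects_cuts (replicate k (False, False) @ x # L) (take (Suc k) r @ drop (Suc k) r)"
          using r by simp_all
        then show "(take (Suc k) r, drop (Suc k) r) \<in> avoiders (lo + ?j) (Suc k) \<times> ?B"
          using respects_cuts_append[OF len(1) False len(2)] avoiders_append_iff[OF len] by blast
      qed
      fix ab assume "ab \<in> avoiders (lo + ?j) (Suc k) \<times> ?B"
      then show "(take (Suc k) (case ab of (a, b) \<Rightarrow> a @ b), drop (Suc k) (case ab of (a, b) \<Rightarrow> a @ b)) = ab"
        using avoiders_length by auto
    qed simp
    from bij_betw_same_card[OF this]
    have "card ?X = catalan_rec (Suc k) * card ?B"
      by (simp add: card_cartesian_product card_avoiders del: catalan_rec.simps)
    moreover have "card ?B = block_weight 1 L" using Cons.IH[of lo 0] by simp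
    ultimately show ?thesis using False by simp
  qed
qed

text \<open>Motzkin words from height h to 0 with two kinds of level letters.
  \<open>(True, True)\<close> is allowed at height 0, since in the queue reading it announces a
  value before one is taken.\<close>

fun ballot :: "nat \<Rightarrow> (bool \<times> bool) list \<Rightarrow> bool" where
  "ballot h [] \<longleftrightarrow> h = 0"
| "ballot h ((True, True) # L) \<longleftrightarrow> ballot h L"
| "ballot h ((False, False) # L) \<longleftrightarrow> ballot h L"
| "ballot h ((False, True) # L) \<longleftrightarrow> ballot (Suc h) L"
| "ballot h ((True, False) # L) \<longleftrightarrow> h > 0 \<and> ballot (h - 1) L"

definition ballots :: "nat \<Rightarrow> nat \<Rightarrow> (bool \<times> bool) list set" where
  "ballots N h = {L. length L = N \<and> ballot h L}"

section \<open>Weighted sums over ballot words\<close>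

lemma finite_ballots: "finite (ballots N h)"
proof (rule finite_subset)
  show "ballots N h \<subseteq> {L. set L \<subseteq> UNIV \<and> length L = N}" by (auto simp: ballots_def)
qed (rule finite_lists_length_eq, simp)

lemma ballots_Suc:
  "ballots (Suc N) h = (#) (False, False) ` ballots N h \<union> (#) (True, True) ` ballots N h
     \<union> (#) (False, True) ` ballots N (Suc h)
     \<union> (if h > 0 then (#) (True, False) ` ballots N (h - 1) else {})"
proof (rule set_eqI)
  fix L
  show "L \<in> ballots (Suc N) h \<longleftrightarrow> L \<in> (#) (False, False) ` ballots N h \<union> (#) (True, True) ` ballots N h
     \<union> (#) (False, True) ` ballots N (Suc h)
     \<union> (if h > 0 then (#) (True, False) ` ballots N (h - 1) else {})"
  proof (cases L)
    case Nil
    then show ?thesis by (auto simp: ballots_def)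
  next
    case (Cons x L')
    obtain u d where "x = (u, d)" by (cases x)
    then show ?thesis using Cons by (cases u; cases d) (auto simp: ballots_def image_iff)
  qed
qed

definition ballot_sum :: "nat \<Rightarrow> nat \<Rightarrow> nat \<Rightarrow> nat" where
  "ballot_sum k h N = (\<Sum>L\<in>ballots N h. block_weight k L)"

lemma ballot_sum_0: "ballot_sum k h 0 = (if h = 0 then catalan_rec k else 0)"
proof -
  have "ballots 0 h = (if h = 0 then {[]} else {})" by (auto simp: ballots_def)
  then show ?thesis by (simp add: ballot_sum_def)
qed

lemma ballot_sum_Suc:
  "ballot_sum k h (Suc N) = ballot_sum (Suc k) h N + catalan_rec k * (ballot_sum 1 h N
     + ballot_sum 1 (Suc h) N + (if h > 0 then ballot_sum 1 (h - 1) N else 0))"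
proof -
  have sum_cons: "(\<Sum>L\<in>(#) x ` X. block_weight k L) = (\<Sum>L\<in>X. block_weight k (x # L))" for x X
    by (simp add: sum.reindex)
  let ?A = "(#) (False, False) ` ballots N h" and ?B = "(#) (True, True) ` ballots N h"
    and ?C = "(#) (False, True) ` ballots N (Suc h)"
    and ?D = "if h > 0 then (#) (True, False) ` ballots N (h - 1) else {}"
  have fin: "finite ?A" "finite ?B" "finite ?C" "finite ?D" by (auto simp: finite_ballots)
  have "ballot_sum k h (Suc N) = sum (block_weight k) ?A + sum (block_weight k) ?B
      + sum (block_weight k) ?C + sum (block_weight k) ?D"
    unfolding ballot_sum_def ballots_Suc
    by (subst sum.union_disjoint, use fin in force, use fin in force, force)+ simp
  also have "sum (block_weight k) ?D = (if h > 0 then catalan_rec k * ballot_sum 1 (h - 1) N else 0)"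
    by (simp add: sum_cons ballot_sum_def sum_distrib_left)
  finally show ?thesis
    by (simp add: sum_cons ballot_sum_def sum_distrib_left[symmetric] algebra_simps)
qed

text \<open>Here s is the number of letters before the first cut, which closes the first block at
  size k + s and leaves N - 1 - s letters. The three summands are its possible types: both, only
  down, only up. In this convolution form the series c(x) - 1 appears as a factor.\<close>

lemma ballot_sum_blocks:
  "ballot_sum k h N = (if h = 0 then catalan_rec (k + N) else 0) +
     (\<Sum>s<N. catalan_rec (k + s) * (ballot_sum 1 h (N - 1 - s) + ballot_sum 1 (Suc h) (N - 1 - s)
        + (if h > 0 then ballot_sum 1 (h - 1) (N - 1 - s) else 0)))"
proof (induction N arbitrary: k)
  case 0
  then show ?case by (simp add: ballot_sum_0)
next
  case (Suc N)
  show ?case unfolding ballot_sum_Suc Suc.IH[of "Suc k"]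
    by (subst sum.lessThan_Suc_shift) simp
qed

text \<open>A Dyck path is given by the list f of the numbers f ! i of down steps before up step i (both counted
  from 0). The up steps are interrupted after index t if f ! t and f ! (t + 1) differ, the down steps
  if t + 1 occurs in f. Decoding keeps the announced values that f has not yet reached in the queue q,
  whose length is the height of the ballot word.\<close>

fun encode :: "nat \<Rightarrow> nat \<Rightarrow> nat list \<Rightarrow> (bool \<times> bool) list" where
  "encode c t [] = []"
| "encode c t (x # xs) = (x \<noteq> c, t \<in> set (x # xs)) # encode x (Suc t) xs"

fun decode :: "nat \<Rightarrow> nat list \<Rightarrow> nat \<Rightarrow> (bool \<times> bool) list \<Rightarrow> nat list" where
  "decode c q t [] = []"
| "decode c q t ((u, d) # L) = (let q' = q @ (if d then [t] else []) in
     if u then hd q' # decode (hd q') (tl q') (Suc t) L else c # decode c q' (Suc t) L)"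

text \<open>c is the current value of the Dyck list before index t, and q holds the announced larger
  values in the order in which they will be reached.\<close>

definition queue_state :: "nat \<Rightarrow> nat list \<Rightarrow> nat \<Rightarrow> bool" where
  "queue_state c q t \<longleftrightarrow> sorted_wrt (<) (c # q) \<and> (\<forall>v\<in>set (c # q). v < t)"

text \<open>\<open>xs\<close> holds the entries of the Dyck list from index t on. The last condition
  says that the queue contains exactly the values below t, other than c, that still occur.\<close>

definition tail_ok :: "nat \<Rightarrow> nat list \<Rightarrow> nat \<Rightarrow> nat list \<Rightarrow> bool" where
  "tail_ok c q t xs \<longleftrightarrow> sorted (c # xs) \<and> (\<forall>i<length xs. xs ! i \<le> t + i) \<and>
     {v \<in> set xs. v < t \<and> v \<noteq> c} = set q"

lemma length_encode [simp]: "length (encode c t xs) = length xs"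
  by (induction xs arbitrary: c t) auto

lemma length_decode [simp]: "length (decode c q t L) = length L"
  by (induction c q t L rule: decode.induct) (auto simp: Let_def)

lemma queue_state_push: "queue_state c q t \<Longrightarrow> queue_state c (q @ (if d then [t] else [])) (Suc t)"
  by (auto simp: queue_state_def sorted_wrt_append less_Suc_eq)

lemma queue_state_pop: "queue_state c (x # q) t \<Longrightarrow> queue_state x q t"
  by (auto simp: queue_state_def)

text \<open>The rules of \<open>ballot\<close> in the order in which \<open>decode\<close> acts:
  push, then pop, with the height as queue length.\<close>

lemma ballot_Cons:
  "ballot (length q) ((u, d) # L) \<longleftrightarrow> (let q' = q @ (if d then [t] else []) in
     if u then q' \<noteq> [] \<and> ballot (length (tl q')) L else ballot (length q') L)"
  by (cases u; cases d; cases q) (auto simp: Let_def)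

text \<open>Every queued value still occurs and the list is sorted, so a jump can only go to the
  smallest queued value, the head. Hence the bare fact that there is a jump suffices to decode
  it.\<close>

lemma ballot_encode:
  assumes "queue_state c q t" "tail_ok c q t xs"
  shows "ballot (length q) (encode c t xs) \<and> decode c q t (encode c t xs) = xs"
  using assms
proof (induction xs arbitrary: c q t)
  case Nil
  then show ?case by (auto simp: tail_ok_def)
next
  case (Cons x xs)
  define d where "d \<longleftrightarrow> t \<in> set (x # xs)"
  define q' where "q' = q @ (if d then [t] else [])"
  have st: "queue_state c q' (Suc t)" unfolding q'_def by (rule queue_state_push[OF Cons.prems(1)])
  have ok: "sorted (c # x # xs)" "\<forall>i<length (x # xs). (x # xs) ! i \<le> t + i"
    "{v \<in> set (x # xs). v < t \<and> v \<noteq> c} = set q"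
    using Cons.prems(2) unfolding tail_ok_def by blast+
  have ct: "c < t" using Cons.prems(1) by (simp add: queue_state_def)
  have bound: "\<forall>i<length xs. xs ! i \<le> Suc t + i"
  proof (intro allI impI)
    fix i assume "i < length xs"
    then show "xs ! i \<le> Suc t + i" using ok(2)[rule_format, of "Suc i"] by simp
  qed
  have set': "{v \<in> set (x # xs). v < Suc t \<and> v \<noteq> c} = set q'"
    using ok(3) ct unfolding q'_def d_def less_Suc_eq by auto
  show ?case
  proof (cases "x = c")
    case True
    have "tail_ok c q' (Suc t) xs"
      unfolding tail_ok_def using ok(1) bound set' True by auto
    from Cons.IH[OF st this]
    have IH: "ballot (length q') (encode c (Suc t) xs)" "decode c q' (Suc t) (encode c (Suc t) xs) = xs"
      by blast+
    have enc: "encode c t (x # xs) = (False, d) # encode c (Suc t) xs"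
      using True by (simp add: d_def)
    show ?thesis
      unfolding enc ballot_Cons[of q False d _ t] decode.simps Let_def q'_def[symmetric]
      using IH True by simp
  next
    case False
    have x: "c < x" "x \<le> t" "\<forall>v\<in>set xs. x \<le> v" "sorted (x # xs)"
      using ok(1) ok(2)[rule_format, of 0] False by auto
    then have xq: "x \<in> set q'" using set' False by auto
    then obtain y q'' where q'': "q' = y # q''" by (cases q') auto
    have sq: "\<forall>v\<in>set q''. y < v" "distinct q'"
      using st q'' by (auto simp: queue_state_def strict_sorted_iff)
    \<comment> \<open>No queued value can be skipped, so the entry x is the head y.\<close>
    have "\<forall>v\<in>set q'. x \<le> v" using set' x(3) by auto
    then have "y = x" using xq sq(1) q'' by fastforce
    then have q'': "q' = x # q''" using q'' by simp
    have "{v \<in> set xs. v < Suc t \<and> v \<noteq> x} = {v \<in> set (x # xs). v < Suc t \<and> v \<noteq> c} - {x}"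
      using x(1,3) by auto
    also have "\<dots> = set q' - {x}" unfolding set' ..
    also have "\<dots> = set q''" using sq(2) q'' by auto
    finally have "tail_ok x q'' (Suc t) xs"
      unfolding tail_ok_def using x(4) bound by blast
    moreover have "queue_state x q'' (Suc t)" using queue_state_pop st unfolding q'' by blast
    ultimately have IH: "ballot (length q'') (encode x (Suc t) xs)"
        "decode x q'' (Suc t) (encode x (Suc t) xs) = xs"
      using Cons.IH[of x q'' "Suc t"] by blast+
    have enc: "encode c t (x # xs) = (True, d) # encode x (Suc t) xs"
      using False by (simp add: d_def)
    show ?thesis
      unfolding enc ballot_Cons[of q True d _ t] decode.simps Let_def q'_def[symmetric]
      using IH q'' by simp
  qed
qed

text \<open>A ballot word ends at height 0, so every queued value is eventually taken. This makes
  the announcement of t equivalent to the later occurrence of t, as \<open>encode\<close>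
  requires.\<close>

lemma tail_ok_decode:
  assumes "queue_state c q t" "ballot (length q) L"
  shows "tail_ok c q t (decode c q t L) \<and> encode c t (decode c q t L) = L"
  using assms
proof (induction L arbitrary: c q t)
  case Nil
  then show ?case by (simp add: tail_ok_def)
next
  case (Cons a L)
  obtain u d where a: "a = (u, d)" by (cases a)
  define q' where "q' = q @ (if d then [t] else [])"
  have st: "queue_state c q' (Suc t)" unfolding q'_def by (rule queue_state_push[OF Cons.prems(1)])
  have bal: "if u then q' \<noteq> [] \<and> ballot (length (tl q')) L else ballot (length q') L"
    using Cons.prems(2) unfolding a ballot_Cons[of q u d L t] q'_def Let_def .
  have qt: "c < t" "\<forall>v\<in>set q. v < t" "\<forall>v\<in>set q. c < v"
    using Cons.prems(1) by (auto simp: queue_state_def)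
  have dq: "d \<longleftrightarrow> t \<in> set q'" "set q' - {t} = set q" using qt by (auto simp: q'_def)
  show ?case
  proof (cases u)
    case False
    define xs where "xs = decode c q' (Suc t) L"
    have IH: "tail_ok c q' (Suc t) xs" "encode c (Suc t) xs = L"
      using Cons.IH[OF st] bal False unfolding xs_def by auto
    have D: "decode c q t (a # L) = c # xs" using False by (simp add: a xs_def q'_def Let_def)
    have set': "{v \<in> set xs. v < Suc t \<and> v \<noteq> c} = set q'"
      and so: "sorted (c # xs)" and bound: "\<forall>i<length xs. xs ! i \<le> Suc t + i"
      using IH(1) unfolding tail_ok_def by blast+
    have "t \<in> set (c # xs) \<longleftrightarrow> d" unfolding dq(1) set'[symmetric] using qt(1) by auto
    then have "encode c t (c # xs) = a # L" using IH(2) False by (simp add: a)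
    moreover have "tail_ok c q t (c # xs)"
      unfolding tail_ok_def
    proof (intro conjI)
      show "sorted (c # c # xs)" using so by auto
      show "\<forall>i<length (c # xs). (c # xs) ! i \<le> t + i"
      proof (intro allI impI)
        fix i assume "i < length (c # xs)"
        then show "(c # xs) ! i \<le> t + i" using bound qt(1) by (cases i) auto
      qed
      show "{v \<in> set (c # xs). v < t \<and> v \<noteq> c} = set q"
        unfolding dq(2)[symmetric] set'[symmetric] by auto
    qed
    ultimately show ?thesis unfolding D by blast
  next
    case True
    obtain x q'' where q'': "q' = x # q''" using bal True by (cases q') auto
    define xs where "xs = decode x q'' (Suc t) L"
    have st'': "queue_state x q'' (Suc t)" using queue_state_pop st unfolding q'' by blast
    have IH: "tail_ok x q'' (Suc t) xs" "encode x (Suc t) xs = L"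
      using Cons.IH[OF st''] bal True unfolding xs_def q'' by auto
    have q'_eq: "q @ (if d then [t] else []) = x # q''" using q'' by (simp add: q'_def)
    have D: "decode c q t (a # L) = x # xs" using True by (simp add: a xs_def q'_eq Let_def)
    have set': "{v \<in> set xs. v < Suc t \<and> v \<noteq> x} = set q''"
      and so: "sorted (x # xs)" and bound: "\<forall>i<length xs. xs ! i \<le> Suc t + i"
      using IH(1) unfolding tail_ok_def by blast+
    have cx: "c < x" "x < Suc t" using st unfolding q'' by (auto simp: queue_state_def)
    have full: "{v \<in> set (x # xs). v < Suc t \<and> v \<noteq> c} = set q'"
    proof -
      have "v \<noteq> c" if "v \<in> set xs" for v using so cx(1) that by fastforce
      then have "{v \<in> set (x # xs). v < Suc t \<and> v \<noteq> c} = insert x {v \<in> set xs. v < Suc t \<and> v \<noteq> x}"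
        using cx by auto
      then show ?thesis unfolding set' q'' by simp
    qed
    have "t \<in> set (x # xs) \<longleftrightarrow> d" unfolding dq(1) full[symmetric] using qt(1) by auto
    then have "encode c t (x # xs) = a # L" using IH(2) True cx(1) by (simp add: a)
    moreover have "tail_ok c q t (x # xs)"
      unfolding tail_ok_def
    proof (intro conjI)
      show "sorted (c # x # xs)" using so cx(1) by fastforce
      show "\<forall>i<length (x # xs). (x # xs) ! i \<le> t + i"
      proof (intro allI impI)
        fix i assume "i < length (x # xs)"
        then show "(x # xs) ! i \<le> t + i" using bound cx(2) by (cases i) auto
      qed
      show "{v \<in> set (x # xs). v < t \<and> v \<noteq> c} = set q"
        unfolding dq(2)[symmetric] full[symmetric] by auto
    qed
    ultimately show ?thesis unfolding D by blast
  qed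
qed

definition dyck_lists :: "nat \<Rightarrow> nat list set" where
  "dyck_lists n = {f. length f = n \<and> sorted f \<and> (\<forall>i<n. f ! i \<le> i)}"

lemma dyck_lists_Cons: "0 # xs \<in> dyck_lists (Suc N) \<longleftrightarrow> length xs = N \<and> tail_ok 0 [] 1 xs"
  by (auto simp: dyck_lists_def tail_ok_def All_less_Suc2)

lemma dyck_lists_cases:
  assumes "f \<in> dyck_lists (Suc N)"
  obtains xs where "f = 0 # xs"
  using assms by (cases f) (auto simp: dyck_lists_def)

text \<open>A nonempty Dyck list begins with 0, so coding starts at index 1 with current value 0 and
  an empty queue. N + 1 entries have N gaps.\<close>

lemma bij_betw_encode: "bij_betw (\<lambda>f. encode 0 1 (tl f)) (dyck_lists (Suc N)) (ballots N 0)"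
proof (rule bij_betwI[where g = "\<lambda>L. 0 # decode 0 [] 1 L"])
  have st: "queue_state 0 [] 1" by (simp add: queue_state_def)
  show "(\<lambda>f. encode 0 1 (tl f)) \<in> dyck_lists (Suc N) \<rightarrow> ballots N 0"
  proof
    fix f assume f: "f \<in> dyck_lists (Suc N)"
    obtain xs where "f = 0 # xs" by (rule dyck_lists_cases[OF f])
    then show "encode 0 1 (tl f) \<in> ballots N 0"
      using ballot_encode[OF st, of xs] dyck_lists_Cons[of xs N] f by (simp add: ballots_def)
  qed
  show "(\<lambda>L. 0 # decode 0 [] 1 L) \<in> ballots N 0 \<rightarrow> dyck_lists (Suc N)"
  proof
    fix L assume "L \<in> ballots N 0"
    then show "0 # decode 0 [] 1 L \<in> dyck_lists (Suc N)"
      using tail_ok_decode[OF st, of L] unfolding dyck_lists_Cons by (simp add: ballots_def)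
  qed
  fix f assume f: "f \<in> dyck_lists (Suc N)"
  obtain xs where "f = 0 # xs" by (rule dyck_lists_cases[OF f])
  then show "0 # decode 0 [] 1 (encode 0 1 (tl f)) = f"
    using ballot_encode[OF st, of xs] dyck_lists_Cons[of xs N] f by simp
next
  have st: "queue_state 0 [] 1" by (simp add: queue_state_def)
  fix L assume "L \<in> ballots N 0"
  then show "encode 0 1 (tl (0 # decode 0 [] 1 L)) = L"
    using tail_ok_decode[OF st, of L] by (simp add: ballots_def)
qed

lemma nth_encode:
  "i < length xs \<Longrightarrow> encode c t xs ! i = ((c # xs) ! i \<noteq> xs ! i, t + i \<in> set (drop i xs))"
proof (induction xs arbitrary: c t i)
  case (Cons x xs)
  then show ?case by (cases i) auto
qed simp

text \<open>For a non-inversion i < l of r, equality of \<open>f ! i\<close> and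
  \<open>f ! l\<close> says that no down step separates up steps i and l. An entry x of f with i < x
  <= l would be an up step between down steps x - 1 and x.\<close>

definition compatible :: "nat list \<Rightarrow> nat list \<Rightarrow> bool" where
  "compatible f r \<longleftrightarrow> (\<forall>i l. i < l \<longrightarrow> l < length r \<longrightarrow> r ! i < r ! l \<longrightarrow>
     f ! i = f ! l \<and> (\<forall>x\<in>set f. \<not> (i < x \<and> x \<le> l)))"

text \<open>Both sides say that no non-inversion of r spans a cut: as f is sorted,
  \<open>f ! i = f ! l\<close> means equality across each gap from i to l, and an entry x of f is a
  cut of the down steps at gap x - 1.\<close>

lemma compatible_iff:
  assumes f: "f \<in> dyck_lists (Suc N)" and r: "r \<in> avoiders lo (Suc N)"
  shows "compatible f r \<longleftrightarrow> respects_cuts (encode 0 1 (tl f)) r"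
proof -
  obtain xs where xs: "f = 0 # xs" by (rule dyck_lists_cases[OF f])
  have len: "length f = Suc N" "length xs = N" and so: "sorted f" and le: "\<And>i. i \<le> N \<Longrightarrow> f ! i \<le> i"
    using f xs by (auto simp: dyck_lists_def)
  have lr: "length r = Suc N" "distinct r" using r avoiders_length by (auto simp: avoiders_def)
  \<comment> \<open>The value t + 1 cannot occur in f before index t + 1, so searching the remaining
    entries is the same as searching all of f.\<close>
  have mark: "encode 0 1 (tl f) ! t = (f ! t \<noteq> f ! Suc t, Suc t \<in> set f)" if "t < N" for t
  proof -
    have "Suc t \<in> set (drop t xs) \<longleftrightarrow> Suc t \<in> set f"
    proof
      assume "Suc t \<in> set f"
      then obtain i where i: "i \<le> N" "f ! i = Suc t" using len by (auto simp: in_set_conv_nth less_Suc_eq_le)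
      then have "Suc t \<le> i" using le[of i] by simp
      then have "drop t xs ! (i - Suc t) = Suc t" "i - Suc t < length (drop t xs)"
        using i len xs that by (auto simp: nth_Cons')
      then show "Suc t \<in> set (drop t xs)" using nth_mem by metis
    next
      assume "Suc t \<in> set (drop t xs)"
      then show "Suc t \<in> set f" using xs by (auto dest: in_set_dropD)
    qed
    then show ?thesis using nth_encode[of t xs 0 1] that len xs by simp
  qed
  show ?thesis
  proof
    assume C: "compatible f r"
    show "respects_cuts (encode 0 1 (tl f)) r"
      unfolding respects_cuts_def
    proof (intro allI impI)
      fix t i l assume H: "t < length (encode 0 1 (tl f))" "encode 0 1 (tl f) ! t \<noteq> (False, False)"
        "i \<le> t" "t < l" "l < length r"
      have t: "t < N" using H(1) len xs by simp
      show "r ! l < r ! i"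
      proof (rule ccontr)
        assume "\<not> r ! l < r ! i"
        moreover have "r ! l \<noteq> r ! i" using lr H by (simp add: nth_eq_iff_index_eq)
        ultimately have "r ! i < r ! l" by simp
        from C[unfolded compatible_def, rule_format, OF _ H(5) this] H(3,4)
        have c: "f ! i = f ! l" "\<forall>x\<in>set f. \<not> (i < x \<and> x \<le> l)" by auto
        have "f ! i \<le> f ! t" "f ! t \<le> f ! Suc t" "f ! Suc t \<le> f ! l"
          using so H(3-5) lr len by (auto intro: sorted_nth_mono)
        then have "f ! t = f ! Suc t" using c(1) by simp
        then have "Suc t \<in> set f" using H(2) mark[OF t] by simp
        then show False using c(2) H(3,4) by auto
      qed
    qed
  next
    assume R: "respects_cuts (encode 0 1 (tl f)) r"
    have cut: False if "t < N" "f ! t \<noteq> f ! Suc t \<or> Suc t \<in> set f" "i \<le> t" "t < l" "l \<le> N" "r ! i < r ! l" for t i l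
      using R[unfolded respects_cuts_def, rule_format, of t i l] that mark[OF that(1)] len lr xs by simp
    show "compatible f r" unfolding compatible_def
    proof (intro allI impI)
      fix i l assume H: "i < l" "l < length r" "r ! i < r ! l"
      have "f ! (i + e) = f ! i" if "i + e \<le> l" for e
        using that
      proof (induction e)
        case (Suc e)
        have "f ! (i + e) = f ! Suc (i + e)"
          using cut[of "i + e" i l] Suc.prems H lr by fastforce
        then show ?case using Suc by simp
      qed simp
      from this[of "l - i"] have "f ! i = f ! l" using H(1) by simp
      moreover have "\<not> (i < x \<and> x \<le> l)" if "x \<in> set f" for x
        using cut[of "x - 1" i l] that H lr by (cases x) auto
      ultimately show "f ! i = f ! l \<and> (\<forall>x\<in>set f. \<not> (i < x \<and> x \<le> l))" by blast
    qed
  qed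
qed

lemma finite_dyck_lists: "finite (dyck_lists n)"
proof (rule finite_subset)
  show "dyck_lists n \<subseteq> {f. set f \<subseteq> {..n} \<and> length f = n}"
    by (auto simp: dyck_lists_def in_set_conv_nth) (meson le_trans less_imp_le_nat)
qed (simp add: finite_lists_length_eq)

lemma card_compatible_pairs:
  "card {(f, r). f \<in> dyck_lists (Suc N) \<and> r \<in> avoiders lo (Suc N) \<and> compatible f r} = ballot_sum 1 0 N"
proof -
  let ?R = "\<lambda>L. {r \<in> avoiders lo (Suc N). respects_cuts L r}"
  have "{(f, r). f \<in> dyck_lists (Suc N) \<and> r \<in> avoiders lo (Suc N) \<and> compatible f r} =
     Sigma (dyck_lists (Suc N)) (\<lambda>f. ?R (encode 0 1 (tl f)))"
    using compatible_iff by auto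
  also have "card \<dots> = (\<Sum>f\<in>dyck_lists (Suc N). card (?R (encode 0 1 (tl f))))"
    using finite_avoiders[of lo "Suc N"] finite_dyck_lists[of "Suc N"] by (intro card_SigmaI) auto
  also have "\<dots> = (\<Sum>L\<in>ballots N 0. card (?R L))"
    by (rule sum.reindex_bij_betw[OF bij_betw_encode])
  also have "\<dots> = ballot_sum 1 0 N"
    unfolding ballot_sum_def
  proof (rule sum.cong[OF refl])
    fix L assume "L \<in> ballots N 0"
    then have "length L = N" by (simp add: ballots_def)
    then show "card (?R L) = block_weight 1 L" using card_respects_cuts[of lo 0 L] by simp
  qed
  finally show ?thesis .
qed

section \<open>Permutations with all cycles of form 312\<close>

lemma strict_mono_enumeration_unique:
  fixes u v :: "nat \<Rightarrow> nat"
  assumes "strict_mono_on {..<n} u" "strict_mono_on {..<n} v" "u ` {..<n} = v ` {..<n}" "i < n"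
  shows "u i = v i"
proof -
  have *: "sorted (map w [0..<n]) \<and> distinct (map w [0..<n])" if "strict_mono_on {..<n} w" for w :: "nat \<Rightarrow> nat"
  proof -
    have "sorted_wrt (\<lambda>x y. w x < w y) [0..<n]"
      using that by (auto simp: sorted_wrt_iff_nth_less strict_mono_on_def)
    then have "sorted_wrt (<) (map w [0..<n])" by (simp only: sorted_wrt_map)
    then show ?thesis by (simp only: strict_sorted_iff)
  qed
  have "map u [0..<n] = map v [0..<n]"
    by (rule sorted_distinct_set_unique) (use * assms(1-3) in \<open>auto simp: atLeast0LessThan\<close>)
  then show ?thesis using assms(4) by (metis add_0 nth_map_upt diff_zero)
qed

text \<open>The positions of the up steps and of the down steps of the Dyck path f, written on the points
  n + 1, ..., 3 n.\<close>

definition bpos :: "nat \<Rightarrow> nat list \<Rightarrow> nat \<Rightarrow> nat" where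
  "bpos n f i = n + 1 + i + f ! i"

definition cpos :: "nat \<Rightarrow> nat list \<Rightarrow> nat \<Rightarrow> nat" where
  "cpos n f j = n + 1 + j + card {x. x < n \<and> f ! x \<le> j}"

lemma dyck_listsD:
  assumes "f \<in> dyck_lists n"
  shows "length f = n" "\<And>i j. i \<le> j \<Longrightarrow> j < n \<Longrightarrow> f ! i \<le> f ! j" "\<And>i. i < n \<Longrightarrow> f ! i \<le> i"
  using assms by (auto simp: dyck_lists_def sorted_nth_mono)

text \<open>Up step x precedes down step j iff \<open>f ! x <= j\<close>. As f is sorted, these x
  form an initial segment, so comparing its size with i decides the order.\<close>

lemma cpos_less_bpos_iff:
  assumes f: "f \<in> dyck_lists n" and "i < n"
  shows "cpos n f j < bpos n f i \<longleftrightarrow> j < f ! i" "bpos n f i < cpos n f j \<longleftrightarrow> f ! i \<le> j"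
proof -
  let ?S = "{x. x < n \<and> f ! x \<le> j}"
  have "cpos n f j < bpos n f i" if "j < f ! i"
  proof -
    have "?S \<subseteq> {..<i}"
    proof
      fix x assume "x \<in> ?S"
      then show "x \<in> {..<i}" using dyck_listsD(2)[OF f, of i x] that by (cases "i \<le> x") auto
    qed
    then have "card ?S \<le> i" using card_mono[of "{..<i}" ?S] by simp
    then show ?thesis using that by (simp add: cpos_def bpos_def)
  qed
  moreover have "bpos n f i < cpos n f j" if "f ! i \<le> j"
  proof -
    have "{..i} \<subseteq> ?S"
    proof
      fix x assume "x \<in> {..i}"
      then show "x \<in> ?S" using dyck_listsD(2)[OF f, of x i] that assms(2) by auto
    qed
    then have "Suc i \<le> card ?S" using card_mono[of ?S "{..i}"] by simp
    then show ?thesis using that by (simp add: cpos_def bpos_def)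
  qed
  ultimately show "cpos n f j < bpos n f i \<longleftrightarrow> j < f ! i" "bpos n f i < cpos n f j \<longleftrightarrow> f ! i \<le> j"
    by (meson less_asym not_le)+
qed

lemma bpos_less_iff:
  assumes "f \<in> dyck_lists n" "i < n" "j < n"
  shows "bpos n f i < bpos n f j \<longleftrightarrow> i < j"
proof -
  have "bpos n f i < bpos n f j" if "i < j" "j < n" for i j
    using dyck_listsD(2)[OF assms(1), of i j] that by (simp add: bpos_def)
  then show ?thesis using assms by (metis less_asym linorder_neqE_nat)
qed

lemma cpos_less_iff: "cpos n f i < cpos n f j \<longleftrightarrow> i < j"
proof -
  have "cpos n f i < cpos n f j" if "i < j" for i j
  proof -
    have "card {x. x < n \<and> f ! x \<le> i} \<le> card {x. x < n \<and> f ! x \<le> j}"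
      by (rule card_mono) (use that in auto)
    then show ?thesis using that by (simp add: cpos_def)
  qed
  then show ?thesis by (metis less_asym linorder_neqE_nat)
qed

lemma positions_partition:
  assumes f: "f \<in> dyck_lists n"
  shows "bpos n f ` {..<n} \<inter> cpos n f ` {..<n} = {}"
    "bpos n f ` {..<n} \<union> cpos n f ` {..<n} = {n + 1..3 * n}"
    "inj_on (bpos n f) {..<n}" "inj_on (cpos n f) {..<n}"
proof -
  show disj: "bpos n f ` {..<n} \<inter> cpos n f ` {..<n} = {}"
    using cpos_less_bpos_iff[OF f] by (auto, metis less_irrefl not_le)
  show inj: "inj_on (bpos n f) {..<n}" "inj_on (cpos n f) {..<n}"
    using bpos_less_iff[OF f] cpos_less_iff[of n f]
    by (auto simp: inj_on_def, metis less_irrefl linorder_neqE_nat, metis less_irrefl linorder_neqE_nat)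
  have card_le: "card {x. x < n \<and> f ! x \<le> j} \<le> n" for j
    using card_mono[of "{..<n}" "{x. x < n \<and> f ! x \<le> j}"] by auto
  have "bpos n f i \<in> {n + 1..3 * n} \<and> cpos n f i \<in> {n + 1..3 * n}" if "i < n" for i
    using that dyck_listsD(3)[OF f that] card_le[of i] by (auto simp: bpos_def cpos_def)
  then have sub: "bpos n f ` {..<n} \<union> cpos n f ` {..<n} \<subseteq> {n + 1..3 * n}" by blast
  have "card (bpos n f ` {..<n} \<union> cpos n f ` {..<n}) = 2 * n"
    using disj inj by (simp add: card_Un_disjoint card_image)
  then show "bpos n f ` {..<n} \<union> cpos n f ` {..<n} = {n + 1..3 * n}"
    using sub by (intro card_subset_eq) auto
qed

text \<open>The permutation with cycles r i -> c i -> b i -> r i, as an association list of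
  positions and values; all other points are fixed.\<close>

definition glue :: "nat \<Rightarrow> nat list \<Rightarrow> nat list \<Rightarrow> nat \<Rightarrow> nat" where
  "glue n f r x = (case map_of (zip (r @ map (bpos n f) [0..<n] @ map (cpos n f) [0..<n])
       (map (cpos n f) [0..<n] @ r @ map (bpos n f) [0..<n])) x of None \<Rightarrow> x | Some y \<Rightarrow> y)"

lemma glue_simps:
  assumes f: "f \<in> dyck_lists n" and r: "distinct r" "set r = {1..<1 + n}"
  shows "\<And>i. i < n \<Longrightarrow> glue n f r (r ! i) = cpos n f i"
    "\<And>i. i < n \<Longrightarrow> glue n f r (cpos n f i) = bpos n f i"
    "\<And>i. i < n \<Longrightarrow> glue n f r (bpos n f i) = r ! i"
    "\<And>x. x \<notin> {1..3 * n} \<Longrightarrow> glue n f r x = x"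
proof -
  note part = positions_partition[OF f]
  define K where "K = r @ map (bpos n f) [0..<n] @ map (cpos n f) [0..<n]"
  define V where "V = map (cpos n f) [0..<n] @ r @ map (bpos n f) [0..<n]"
  have lr: "length r = n" using distinct_card[OF r(1)] r(2) by simp
  then have len: "length K = 3 * n" "length V = 3 * n" by (simp_all add: K_def V_def)
  have glue: "glue n f r x = (case map_of (zip K V) x of None \<Rightarrow> x | Some y \<Rightarrow> y)" for x
    by (simp add: glue_def K_def V_def)
  have sets: "set (map (bpos n f) [0..<n]) = bpos n f ` {..<n}" "set (map (cpos n f) [0..<n]) = cpos n f ` {..<n}"
    by (simp_all add: atLeast0LessThan)
  have upper: "bpos n f ` {..<n} \<inter> {1..<1 + n} = {}" "cpos n f ` {..<n} \<inter> {1..<1 + n} = {}"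
    by (auto simp: bpos_def cpos_def)
  have dist: "distinct K"
  proof -
    have "distinct (map (bpos n f) [0..<n])" "distinct (map (cpos n f) [0..<n])"
      using part(3,4) by (simp_all add: distinct_map atLeast0LessThan)
    then show ?thesis
      unfolding K_def distinct_append set_append sets r(2) using r(1) part(1) upper by blast
  qed
  have setK: "set K = {1..3 * n}"
  proof -
    have "set K = {1..<1 + n} \<union> (bpos n f ` {..<n} \<union> cpos n f ` {..<n})"
      unfolding K_def set_append sets r(2) ..
    also have "\<dots> = {1..3 * n}" unfolding part(2) by auto
    finally show ?thesis .
  qed
  have nth: "glue n f r (K ! m) = V ! m" if "m < 3 * n" for m
  proof -
    have "map_of (zip K V) (K ! m) = Some (V ! m)"
      by (rule map_of_zip_nth) (simp_all add: that len dist)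
    then show ?thesis by (simp add: glue)
  qed
  show "glue n f r (r ! i) = cpos n f i" if "i < n" for i
  proof -
    have "K ! i = r ! i" "V ! i = cpos n f i" using that lr by (simp_all add: K_def V_def nth_append)
    then show ?thesis using nth[of i] that by simp
  qed
  show "glue n f r (bpos n f i) = r ! i" if "i < n" for i
  proof -
    have "K ! (n + i) = bpos n f i" "V ! (n + i) = r ! i" using that lr by (simp_all add: K_def V_def nth_append)
    then show ?thesis using nth[of "n + i"] that by simp
  qed
  show "glue n f r (cpos n f i) = bpos n f i" if "i < n" for i
  proof -
    have "K ! (n + n + i) = cpos n f i" "V ! (n + n + i) = bpos n f i"
      using that lr by (simp_all add: K_def V_def nth_append)
    then show ?thesis using nth[of "n + n + i"] that by simp
  qed
  show "glue n f r x = x" if "x \<notin> {1..3 * n}" for x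
  proof -
    have "x \<notin> set K" using that unfolding setK .
    then have "map_of (zip K V) x = None"
      using map_of_zip_is_None[of K V x] len by simp
    then show ?thesis by (simp add: glue)
  qed
qed

lemma positions_cases:
  assumes f: "f \<in> dyck_lists n" and r: "set r = {1..<1 + n}" "length r = n" and "x \<in> {1..3 * n}"
  obtains i where "i < n" "x = r ! i" | i where "i < n" "x = bpos n f i" | i where "i < n" "x = cpos n f i"
proof (cases "x \<le> n")
  case True
  then have "x \<in> set r" using assms by auto
  then show ?thesis using that(1) r(2) by (metis in_set_conv_nth)
next
  case False
  then have "x \<in> bpos n f ` {..<n} \<union> cpos n f ` {..<n}"
    using assms(4) unfolding positions_partition(2)[OF f] by simp
  then show ?thesis using that(2,3) by blast
qed

text \<open>Classify the positions of a pattern as r, b or c; they carry values of type c, r and b.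
  Types rrr and bbb give a 132 pattern in the list r. Type rrc gives an up step between two down
  steps over a non-inversion, and bcb a down step between two up steps over a non-inversion;
  \<open>compatible\<close> excludes both. Two final positions of type c carry increasing values.
  The sizes of positions and values exclude everything else.\<close>

lemma glue_in_A_set:
  assumes f: "f \<in> dyck_lists n" and r: "r \<in> avoiders 1 n" and comp: "compatible f r"
  shows "glue n f r \<in> A_set (3 * n)"
proof -
  have rd: "distinct r" "set r = {1..<1 + n}" "avoids132 r" and lr: "length r = n"
    using r avoiders_length[OF r] by (auto simp: avoiders_def)
  let ?p = "glue n f r" and ?b = "bpos n f" and ?c = "cpos n f"
  note p = glue_simps[OF f rd(1,2)] 
    and pcases = positions_cases[OF f rd(2) lr, consumes 1, case_names 1 2 3]
  note bc = cpos_less_bpos_iff[OF f] and b = bpos_less_iff[OF f] and c = cpos_less_iff[of n f]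
  have r_le: "1 \<le> r ! i" "r ! i \<le> n" if "i < n" for i
    using nth_mem[of i r] that lr rd(2) by auto
  have big: "n < ?b i" "n < ?c i" for i by (simp_all add: bpos_def cpos_def)
  have b_less_c: "?b i < ?c i" if "i < n" for i
    using bc(2)[OF that] dyck_listsD(3)[OF f that] by simp
  have tc: "three_cyclic (3 * n) ?p"
  proof (rule three_cyclicI)
    fix x assume "x \<notin> {1..3 * n}"
    then show "?p x = x" by (rule p(4))
  next
    fix x assume "x \<in> {1..3 * n}"
    then show "?p x \<noteq> x"
    proof (cases rule: pcases)
      case (1 i) then show ?thesis using p(1)[of i] r_le[of i] big(2)[of i] by simp
    next
      case (2 i) then show ?thesis using p(3)[of i] r_le[of i] big(1)[of i] by simp
    next
      case (3 i) then show ?thesis using p(2)[of i] b_less_c[of i] by simp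
    qed
  next
    fix x
    show "?p (?p (?p x)) = x"
    proof (cases "x \<in> {1..3 * n}")
      case True
      then show ?thesis by (cases rule: pcases) (simp_all add: p(1-3))
    next
      case False
      have "?p x = x" using False by (rule p(4))
      then show ?thesis by simp
    qed
  qed
  have pure: "\<not> has_231_cycle_at ?p x" for x
  proof
    assume h: "has_231_cycle_at ?p x"
    then have "x \<in> {1..3 * n}"
      by (intro three_cyclic_moved[OF tc]) (simp add: has_231_cycle_at_def)
    then show False
    proof (cases rule: pcases)
      case (1 i) then show ?thesis using h b_less_c[of i] by (simp add: p has_231_cycle_at_def)
    next
      case (2 i) then show ?thesis using h r_le[of i] big(1)[of i] by (simp add: p has_231_cycle_at_def)
    next
      case (3 i) then show ?thesis using h b_less_c[of i] by (simp add: p has_231_cycle_at_def)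
    qed
  qed
  have list132: False if "i < j" "j < k" "k < n" "r ! i < r ! k" "r ! k < r ! j" for i j k
    using rd(3) that lr unfolding avoids132_iff_nth[OF rd(1)] by blast
  have comp1: "f ! i = f ! l" if "i < l" "l < n" "r ! i < r ! l" for i l
    using comp that lr unfolding compatible_def by blast
  have comp2: False if "i < l" "l < n" "r ! i < r ! l" "m < n" "i < f ! m" "f ! m \<le> l" for i l m
  proof -
    have "f ! m \<in> set f" using that(4) dyck_listsD(1)[OF f] by simp
    then show False using comp that lr unfolding compatible_def by blast
  qed
  have "no132 ?p"
    unfolding no132_def
  proof (intro allI impI notI)
    fix x y z :: nat
    assume o: "1 \<le> x" "x < y" "y < z" and "?p x < ?p z \<and> ?p z < ?p y"
    then have pat: "?p x < ?p z" "?p z < ?p y" by auto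
    have "z \<le> 3 * n"
    proof (rule ccontr)
      assume "\<not> z \<le> 3 * n"
      moreover from this have "?p z = z" by (intro p(4)) simp
      moreover have "?p y \<le> z"
        using permutes_interval_le[of ?p "3 * n" y z] tc o \<open>\<not> z \<le> 3 * n\<close> by (simp add: three_cyclic_def)
      ultimately show False using pat by simp
    qed
    then have range: "x \<in> {1..3 * n}" "y \<in> {1..3 * n}" "z \<in> {1..3 * n}" using o by auto
    have increasing: False if "i < n" "y = ?c i" "l < n" "z = ?c l" for i l
      using o(3) pat(2) that c[of i l] b[of l i] by (simp add: p)
    from range(1) show False
    proof (cases rule: pcases)
      case x: (1 i)
      then have px: "?p x = ?c i" by (simp add: p)
      from range(3) show False
      proof (cases rule: pcases)
        case z: (1 l)
        from range(2) show False
        proof (cases rule: pcases)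
          case y: (1 j)
          have "i < l" "l < j" using pat x y z c by (simp_all add: p)
          then show False using list132[of i l j] o x y z by simp
        next
          case (2 j) then show False using o z r_le[of l] big(1)[of j] by simp
        next
          case (3 j) then show False using o z r_le[of l] big(2)[of j] by simp
        qed
      next
        case z: (2 l)
        then show False using pat(1) px r_le[of l] big(2)[of i] by (simp add: p)
      next
        case z: (3 l)
        then have pz: "?p z = ?b l" by (simp add: p)
        from range(2) show False
        proof (cases rule: pcases)
          case y: (1 j)
          have "?c i < ?b l" "?b l < ?c j" using pat px pz y by (simp_all add: p)
          moreover from this have "i < j" using c[of i j] by simp
          ultimately show False using comp2[of i j l] bc[OF z(1)] o x y z by simp
        next
          case (2 j) then show False using pat(2) pz r_le[of j] big(1)[of l] by (simp add: p)
        next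
          case (3 j) then show False using increasing z by blast
        qed
      qed
    next
      case x: (2 i)
      then have px: "?p x = r ! i" by (simp add: p)
      from range(3) show False
      proof (cases rule: pcases)
        case z: (1 l) then show False using o x r_le[of l] big(1)[of i] by simp
      next
        case z: (2 l)
        then have pz: "?p z = r ! l" by (simp add: p)
        have il: "i < l" "r ! i < r ! l" using o x z b[of i l] pat px pz by auto
        from range(2) show False
        proof (cases rule: pcases)
          case y: (1 j) then show False using o x r_le[of j] big(1)[of i] by simp
        next
          case y: (2 j)
          have "i < j" "j < l" using o x y z b by auto
          moreover have "r ! l < r ! j" using pat(2) pz y by (simp add: p)
          ultimately show False using list132[of i j l] il z by simp
        next
          case y: (3 j)
          have "f ! i \<le> j" "j < f ! l" using o x y z bc by auto
          then show False using comp1[OF il(1) z(1) il(2)] by simp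
        qed
      next
        case z: (3 l)
        then have pz: "?p z = ?b l" by (simp add: p)
        from range(2) show False
        proof (cases rule: pcases)
          case (1 j) then show False using o x r_le[of j] big(1)[of i] by simp
        next
          case (2 j) then show False using pat(2) pz r_le[of j] big(1)[of l] by (simp add: p)
        next
          case (3 j) then show False using increasing z by blast
        qed
      qed
    next
      case x: (3 i)
      then have px: "?p x = ?b i" by (simp add: p)
      then have "n < ?p z" "n < ?p y" using pat big(1)[of i] by linarith+
      moreover have "n < y" "n < z" using o x big(2)[of i] by linarith+
      ultimately have "\<exists>j<n. w = ?c j" if "w = y \<or> w = z" for w
      proof -
        have w: "n < w" "n < ?p w" "w \<in> {1..3 * n}"
          using that range \<open>n < ?p z\<close> \<open>n < ?p y\<close> \<open>n < y\<close> \<open>n < z\<close> by auto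
        from w(3) show ?thesis
        proof (cases rule: pcases)
          case (1 j) then show ?thesis using w(1) r_le[of j] by simp
        next
          case (2 j) then show ?thesis using w(2) r_le[of j] by (simp add: p)
        next
          case (3 j) then show ?thesis by blast
        qed
      qed
      then show False using increasing by blast
    qed
  qed
  then show ?thesis using tc pure A_set_iff by blast
qed

text \<open>Reads the up steps off the permutation; their increasing enumeration then gives f, and
  their images give r.\<close>

lemma small_values_glue:
  assumes f: "f \<in> dyck_lists n" and r: "r \<in> avoiders 1 n"
  shows "{x \<in> {n + 1..3 * n}. glue n f r x \<le> n} = bpos n f ` {..<n}"
proof -
  have rd: "distinct r" "set r = {1..<1 + n}" and lr: "length r = n"
    using r avoiders_length[OF r] by (auto simp: avoiders_def)
  note p = glue_simps[OF f rd] and part = positions_partition[OF f]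
  have small: "glue n f r (bpos n f i) \<le> n" if "i < n" for i
  proof -
    have "r ! i \<in> set r" using that lr by simp
    then have "r ! i \<le> n" unfolding rd(2) by simp
    then show ?thesis unfolding p(3)[OF that] .
  qed
  have large: "\<not> glue n f r (cpos n f i) \<le> n" if "i < n" for i
    unfolding p(2)[OF that] by (simp add: bpos_def)
  show ?thesis unfolding part(2)[symmetric] using small large by blast
qed

lemma glue_inject:
  assumes f: "f \<in> dyck_lists n" and r: "r \<in> avoiders 1 n"
    and f': "f' \<in> dyck_lists n" and r': "r' \<in> avoiders 1 n"
    and eq: "glue n f r = glue n f' r'"
  shows "f = f' \<and> r = r'"
proof -
  have img: "bpos n f ` {..<n} = bpos n f' ` {..<n}"
    using small_values_glue[OF f r] small_values_glue[OF f' r'] unfolding eq by (rule trans[OF sym])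
  have mono: "strict_mono_on {..<n} (bpos n g)" if "g \<in> dyck_lists n" for g
    using bpos_less_iff[OF that] by (auto simp: strict_mono_on_def)
  have b: "bpos n f i = bpos n f' i" if "i < n" for i
    by (rule strict_mono_enumeration_unique[OF mono[OF f] mono[OF f'] img that])
  have "f = f'"
  proof (rule nth_equalityI)
    show "length f = length f'" using dyck_listsD(1) f f' by simp
    fix i assume "i < length f"
    then show "f ! i = f' ! i" using b[of i] dyck_listsD(1)[OF f] by (simp add: bpos_def)
  qed
  moreover have "r = r'"
  proof (rule nth_equalityI)
    show "length r = length r'" using avoiders_length r r' by simp
    fix i assume "i < length r"
    then have i: "i < n" using avoiders_length[OF r] by simp
    have rd: "distinct r" "set r = {1..<1 + n}" "distinct r'" "set r' = {1..<1 + n}"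
      using r r' by (auto simp: avoiders_def)
    show "r ! i = r' ! i"
      using glue_simps(3)[OF f rd(1,2) i] glue_simps(3)[OF f' rd(3,4) i] b[OF i] eq by simp
  qed
  ultimately show ?thesis by blast
qed

text \<open>Index the cycles by increasing middle element b. Then \<open>pure_312_increasing\<close>
  makes the largest elements c increase as well, so they enumerate what b leaves of
  \<open>{n + 1..3 * n}\<close>, and f is read off b. Any failure of compatibility produces a 132
  pattern of p.\<close>

lemma A_set_is_glue:
  assumes p: "p \<in> A_set (3 * n)"
  obtains f r where "f \<in> dyck_lists n" "r \<in> avoiders 1 n" "compatible f r" "p = glue n f r"
proof -
  have tc: "three_cyclic (3 * n) p" and no: "no132 p" and pure: "\<And>x. \<not> has_231_cycle_at p x"
    using p A_set_iff by blast+
  note cube = three_cyclic_cube[OF tc] and inj = three_cyclic_inj[OF tc]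
    and above = pure_312_above[OF tc no pure] and mins = pure_312_minima[OF tc no pure]
  have min: "cycle_min p x" if "x \<in> {1..n}" for x using mins that by blast
  have range: "p x \<in> {1..3 * n}" "p (p x) \<in> {1..3 * n}" if "x \<in> {1..n}" for x
    using three_cyclic_facts(5,6)[OF tc, of x] that by auto
  define S where "S = (\<lambda>x. p (p x)) ` {1..n}"
  have cardS: "card S = n" and finS: "finite S"
    using cycles_of_minima(5)[OF tc min finite_atLeastAtMost] by (simp_all add: S_def)
  define b where "b i = sorted_list_of_set S ! i" for i
  define c where "c i = p (p (b i))" for i
  have b_img: "b ` {..<n} = S"
  proof -
    have "b ` {..<n} = set (sorted_list_of_set S)"
      using cardS by (auto simp: b_def set_conv_nth)
    then show ?thesis using finS by simp
  qed
  have b_mono: "b i < b j" if "i < j" "j < n" for i j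
    using strict_sorted_list_of_set[of S] that cardS by (simp add: b_def sorted_wrt_iff_nth_less)
  have b_less: "b i < b j \<longleftrightarrow> i < j" if "i < n" "j < n" for i j
    using b_mono[of i j] b_mono[of j i] that by (cases i j rule: linorder_cases) auto
  have pb: "p (b i) \<in> {1..n}" "p (c i) = b i" "p (p (b i)) = c i" if "i < n" for i
  proof -
    have "b i \<in> S" using b_img that by blast
    then show "p (b i) \<in> {1..n}" unfolding S_def using cube by auto
    show "p (c i) = b i" "p (p (b i)) = c i" by (simp_all add: c_def cube)
  qed
  have bS: "n < b i" "b i \<le> 3 * n" "n < c i" "c i \<le> 3 * n" "b i < c i" if "i < n" for i
  proof -
    have r: "p (b i) \<in> {1..n}" "b i = p (p (p (b i)))" using pb(1)[OF that] cube by simp_all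
    then show "n < b i" "n < c i" "b i < c i" using above[of "p (b i)"] by (simp_all add: c_def)
    show "b i \<le> 3 * n" "c i \<le> 3 * n"
      using range[OF r(1)] r(2) by (simp_all add: c_def)
  qed
  have c_mono: "c i < c j" if "i < j" "j < n" for i j
  proof (rule ccontr)
    assume "\<not> c i < c j"
    moreover have "c i \<noteq> c j" using b_mono[OF that] by (simp add: c_def inj)
    ultimately have "c j < c i" by simp
    then have "p (c j) < p (c i)"
      using pure_312_increasing[OF tc no pure, of "c j" "c i"] bS pb that by simp
    then show False using b_mono[OF that] pb that by simp
  qed
  have c_less: "c i < c j \<longleftrightarrow> i < j" if "i < n" "j < n" for i j
    using c_mono[of i j] c_mono[of j i] that by (cases i j rule: linorder_cases) auto
  have cover: "x \<in> b ` {..<n} \<or> x \<in> c ` {..<n}" if x: "n < x" "x \<le> 3 * n" for x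
  proof -
    have "x \<in> {1..3 * n}" using x by simp
    from cycle_min_exists[OF tc this] obtain a where a: "cycle_min p a" "x = a \<or> x = p a \<or> x = p (p a)"
      by blast
    have an: "a \<in> {1..n}" using a(1) mins by blast
    then have "p (p a) \<in> b ` {..<n}" unfolding b_img S_def by blast
    then obtain i where i: "i < n" "p (p a) = b i" by auto
    have "c i = p a" unfolding c_def i(2)[symmetric] by (simp add: cube)
    then have "x = c i \<or> x = b i" using a(2) an i x by auto
    then show ?thesis using i(1) by blast
  qed
  define f where "f = map (\<lambda>i. b i - (n + 1 + i)) [0..<n]"
  define r where "r = map (\<lambda>i. p (b i)) [0..<n]"
  have b_ge: "n + 1 + i \<le> b i" if "i < n" for i
    using that
  proof (induction i)
    case 0
    then show ?case using bS(1)[of 0] by simp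
  next
    case (Suc i)
    then show ?case using b_mono[of i "Suc i"] by simp
  qed
  \<comment> \<open>Up to b i there are only b 0, ..., b i and those c j with j < i, because b i < c
    i. This count becomes \<open>f ! i <= i\<close>.\<close>
  have b_le: "b i \<le> n + 1 + i + i" if "i < n" for i
  proof -
    have "{n + 1..b i} \<subseteq> b ` {..i} \<union> c ` {..<i}"
    proof
      fix x assume x: "x \<in> {n + 1..b i}"
      then have "n < x" "x \<le> 3 * n" using bS(2)[OF that] by auto
      from cover[OF this] show "x \<in> b ` {..i} \<union> c ` {..<i}"
      proof
        assume "x \<in> b ` {..<n}"
        then obtain j where j: "j < n" "x = b j" by auto
        then have "\<not> b i < b j" using x by simp
        then have "j \<le> i" using b_less[OF that j(1)] by simp
        then show ?thesis using j by blast
      next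
        assume "x \<in> c ` {..<n}"
        then obtain j where j: "j < n" "x = c j" by auto
        then have "c j < c i" using x bS(5)[OF that] by simp
        then have "j < i" using c_less[OF j(1) that] by simp
        then show ?thesis using j by blast
      qed
    qed
    then have "card {n + 1..b i} \<le> card (b ` {..i} \<union> c ` {..<i})" by (intro card_mono) auto
    also have "\<dots> \<le> card (b ` {..i}) + card (c ` {..<i})" by (rule card_Un_le)
    also have "\<dots> \<le> Suc i + i"
      using card_image_le[of "{..i}" b] card_image_le[of "{..<i}" c] by simp
    finally show ?thesis by simp
  qed
  have fi: "f ! i = b i - (n + 1 + i)" if "i < n" for i using that by (simp add: f_def)
  have f: "f \<in> dyck_lists n"
  proof -
    have "f ! i \<le> f ! j" if "i \<le> j" "j < n" for i j
      using that
    proof (induction j)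
      case (Suc j)
      show ?case
      proof (cases "i = Suc j")
        case False
        have "f ! j \<le> f ! Suc j"
          using b_mono[of j "Suc j"] Suc.prems fi[of j] fi[of "Suc j"] by simp
        then show ?thesis using Suc False by simp
      qed simp
    qed simp
    then have "sorted f" by (simp add: sorted_iff_nth_mono f_def)
    moreover have "f ! i \<le> i" if "i < n" for i
      using b_le[OF that] fi[OF that] by simp
    ultimately show ?thesis by (simp add: dyck_lists_def f_def)
  qed
  have bpos: "bpos n f i = b i" if "i < n" for i
    using b_ge[OF that] fi[OF that] by (simp add: bpos_def)
  \<comment> \<open>Both functions enumerate the complement of the b positions in increasing
    order.\<close>
  have cpos: "cpos n f i = c i" if "i < n" for i
  proof (rule strict_mono_enumeration_unique[OF _ _ _ that])
    show "strict_mono_on {..<n} (cpos n f)" using cpos_less_iff by (auto simp: strict_mono_on_def)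
    show "strict_mono_on {..<n} c" using c_mono by (auto simp: strict_mono_on_def)
    have bimg: "bpos n f ` {..<n} = b ` {..<n}" using bpos by auto
    have "cpos n f ` {..<n} = {n + 1..3 * n} - bpos n f ` {..<n}"
      using positions_partition(1,2)[OF f] by blast
    also have "\<dots> = c ` {..<n}"
    proof -
      have ne: "c i \<noteq> b j" if "i < n" "j < n" for i j
      proof
        assume "c i = b j"
        then have "p (c i) = p (b j)" by simp
        then show False using pb(1)[OF that(2)] pb(2)[OF that(1)] bS(1)[OF that(1)] by simp
      qed
      show ?thesis unfolding bimg
      proof (intro equalityI subsetI)
        fix x assume "x \<in> {n + 1..3 * n} - b ` {..<n}"
        then show "x \<in> c ` {..<n}" using cover[of x] by auto
      next
        fix x assume "x \<in> c ` {..<n}"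
        then obtain i where i: "i < n" "x = c i" by auto
        then have "x \<notin> b ` {..<n}" using ne by auto
        then show "x \<in> {n + 1..3 * n} - b ` {..<n}" using i bS[OF i(1)] by simp
      qed
    qed
    finally show "cpos n f ` {..<n} = c ` {..<n}" .
  qed
  have ri: "r ! i = p (b i)" if "i < n" for i using that by (simp add: r_def)
  have lr: "length r = n" by (simp add: r_def)
  have rd: "distinct r" "set r = {1..<1 + n}"
  proof -
    have "inj_on (\<lambda>i. p (b i)) {..<n}"
    proof (rule inj_onI)
      fix i j assume "i \<in> {..<n}" "j \<in> {..<n}" "p (b i) = p (b j)"
      then show "i = j" using b_less[of i j] b_less[of j i] inj by auto
    qed
    then show "distinct r" by (simp add: r_def distinct_map atLeast0LessThan)
    have "set r \<subseteq> {1..<1 + n}" using pb(1) by (auto simp: r_def less_Suc_eq_le)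
    moreover have "card (set r) = n" using \<open>distinct r\<close> lr by (simp add: distinct_card)
    ultimately show "set r = {1..<1 + n}" by (intro card_subset_eq) auto
  qed
  have "avoids132 r"
    unfolding avoids132_iff_nth[OF rd(1)]
  proof (intro allI impI notI)
    fix i j k assume H: "i < j" "j < k" "k < length r" "r ! i < r ! k \<and> r ! k < r ! j"
    then show False
      using no132D[OF no, of "b i" "b j" "b k"] b_mono[of i j] b_mono[of j k] bS(1)[of i] ri lr by simp
  qed
  then have r: "r \<in> avoiders 1 n" using rd by (simp add: avoiders_def)
  have comp: "compatible f r"
    unfolding compatible_def
  proof (intro allI impI)
    fix i l assume H: "i < l" "l < length r" "r ! i < r ! l"
    have il: "i < n" "l < n" using H lr by auto
    have ril: "1 \<le> r ! i" "r ! l \<le> n" using pb(1)[OF il(1)] pb(1)[OF il(2)] ri il by auto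
    have "f ! i = f ! l"
    proof (rule ccontr)
      assume "f ! i \<noteq> f ! l"
      then have fil: "f ! i < f ! l" using dyck_listsD(2)[OF f, of i l] H il by simp
      \<comment> \<open>Down step number \<open>f ! i\<close> is the first one after up step i, and
        it precedes up step l. Positions b i, c j, b l then carry r i, b j, r l, a 132
        pattern.\<close>
      define j where "j = f ! i"
      have j: "j < n" using fil dyck_listsD(3)[OF f il(2)] il by (simp add: j_def)
      have "b i < c j" "c j < b l"
        using cpos_less_bpos_iff(2)[OF f il(1), of j] cpos_less_bpos_iff(1)[OF f il(2), of j] fil
        unfolding bpos[OF il(1)] bpos[OF il(2)] cpos[OF j] by (simp_all add: j_def)
      moreover have "p (b l) < p (c j)" using pb(2)[OF j] bS(1)[OF j] ri[OF il(2)] ril by simp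
      ultimately show False
        using no132D[OF no, of "b i" "c j" "b l"] bS(1)[OF il(1)] H(3) ri il by simp
    qed
    moreover have "\<not> (i < x \<and> x \<le> l)" if "x \<in> set f" for x
    proof
      assume x: "i < x \<and> x \<le> l"
      from that obtain m where m: "m < n" "x = f ! m"
        unfolding in_set_conv_nth dyck_listsD(1)[OF f] by blast
      \<comment> \<open>Now b m separates c i from c l, so positions r i, r l, c m carry c i, c l, b
        m, again a 132 pattern.\<close>
      have "c i < b m" "b m < c l"
        using cpos_less_bpos_iff(1)[OF f m(1), of i] cpos_less_bpos_iff(2)[OF f m(1), of l] x m(2)
        unfolding bpos[OF m(1)] cpos[OF il(1)] cpos[OF il(2)] by simp_all
      moreover have "p (r ! i) = c i" "p (r ! l) = c l" using ri il by (simp_all add: c_def)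
      moreover have "r ! l < c m" using ril bS(3)[OF m(1)] by simp
      ultimately show False
        using no132D[OF no, of "r ! i" "r ! l" "c m"] ril H(3) pb(2)[OF m(1)] by simp
    qed
    ultimately show "f ! i = f ! l \<and> (\<forall>x\<in>set f. \<not> (i < x \<and> x \<le> l))" by blast
  qed
  have "p = glue n f r"
  proof
    fix x
    note g = glue_simps[OF f rd]
    show "p x = glue n f r x"
    proof (cases "x \<in> {1..3 * n}")
      case True
      then show ?thesis
      proof (cases rule: positions_cases[OF f rd(2) lr, consumes 1, case_names 1 2 3])
        case (1 i)
        then show ?thesis using g(1)[of i] cpos[of i] ri[of i] by (simp add: c_def)
      next
        case (2 i)
        then show ?thesis using g(3)[of i] bpos[of i] ri[of i] by simp
      next
        case (3 i)
        then show ?thesis using g(2)[of i] cpos[of i] bpos[of i] pb(2)[of i] by simp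
      qed
    next
      case False
      then show ?thesis using g(4) three_cyclic_outside[OF tc] by simp
    qed
  qed
  then show thesis using that f r comp by blast
qed

lemma card_A_set: "card (A_set (3 * Suc N)) = ballot_sum 1 0 N"
proof -
  let ?X = "{(f, r). f \<in> dyck_lists (Suc N) \<and> r \<in> avoiders 1 (Suc N) \<and> compatible f r}"
  have "bij_betw (\<lambda>(f, r). glue (Suc N) f r) ?X (A_set (3 * Suc N))"
    unfolding bij_betw_def
  proof
    show "inj_on (\<lambda>(f, r). glue (Suc N) f r) ?X"
    proof (rule inj_onI, clarify)
      fix f r f' r'
      assume "f \<in> dyck_lists (Suc N)" "r \<in> avoiders 1 (Suc N)" "f' \<in> dyck_lists (Suc N)"
        "r' \<in> avoiders 1 (Suc N)" "glue (Suc N) f r = glue (Suc N) f' r'"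
      then show "f = f' \<and> r = r'" by (rule glue_inject)
    qed
    show "(\<lambda>(f, r). glue (Suc N) f r) ` ?X = A_set (3 * Suc N)"
    proof
      show "(\<lambda>(f, r). glue (Suc N) f r) ` ?X \<subseteq> A_set (3 * Suc N)"
        by (clarify, rule glue_in_A_set)
      show "A_set (3 * Suc N) \<subseteq> (\<lambda>(f, r). glue (Suc N) f r) ` ?X"
      proof
        fix p assume "p \<in> A_set (3 * Suc N)"
        then obtain f r where "f \<in> dyck_lists (Suc N)" "r \<in> avoiders 1 (Suc N)" "compatible f r"
          "p = glue (Suc N) f r"
          by (rule A_set_is_glue)
        then show "p \<in> (\<lambda>(f, r). glue (Suc N) f r) ` ?X"
          by (intro image_eqI[where x = "(f, r)"]) simp_all
      qed
    qed
  qed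
  from bij_betw_same_card[OF this] show ?thesis unfolding card_compatible_pairs by simp
qed

section \<open>Generating functions\<close>

unbundle fps_syntax

section \<open>Catalan numbers: recurrence and closed formula\<close>

lemma catalan_rec_fps:
  fixes C :: "rat fps"
  defines "C \<equiv> Abs_fps (\<lambda>n. of_nat (catalan_rec n))"
  shows "C = 1 + fps_X * C ^ 2"
proof (rule fps_ext)
  fix n
  show "C $ n = (1 + fps_X * C ^ 2) $ n"
  proof (cases n)
    case 0
    then show ?thesis by (simp add: C_def)
  next
    case (Suc k)
    have "(C ^ 2) $ k = (\<Sum>i=0..k. of_nat (catalan_rec i) * of_nat (catalan_rec (k - i)))"
      by (simp add: power2_eq_square fps_mult_nth C_def)
    also have "\<dots> = of_nat (catalan_rec (Suc k))" by (simp add: atMost_atLeast0)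
    finally show ?thesis using Suc by (simp add: C_def)
  qed
qed

lemma central_binomial_Suc:
  "(of_nat k + 1) * of_nat ((2 * Suc k) choose Suc k) = (2 * (2 * of_nat k + 1) * of_nat ((2 * k) choose k) :: rat)"
proof -
  have "of_nat ((2 * Suc k) choose Suc k) = (fact (2 * Suc k) / (fact (Suc k) * fact (Suc k)) :: rat)"
    by (subst binomial_fact) simp_all
  also have "\<dots> = (2 * of_nat k + 2) * (2 * of_nat k + 1) * fact (2 * k) / (((of_nat k + 1) * fact k) * ((of_nat k + 1) * fact k))"
    by (simp add: fact_Suc algebra_simps)
  also have "\<dots> = (2 * (2 * of_nat k + 1) / (of_nat k + 1)) * (fact (2 * k) / (fact k * fact k))"
  proof -
    have nz: "(of_nat k + 1 :: rat) \<noteq> 0" by (metis of_nat_Suc of_nat_neq_0 add.commute)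
    show ?thesis using nz by (simp add: divide_simps) (simp add: algebra_simps)
  qed
  also have "fact (2 * k) / (fact k * fact k) = (of_nat ((2 * k) choose k) :: rat)"
    by (subst binomial_fact) simp_all
  finally show ?thesis
    by (metis (no_types, lifting) nonzero_mult_div_cancel_left of_nat_Suc of_nat_neq_0 add.commute times_divide_eq_left times_divide_eq_right)
qed

lemma catalan_Suc: "(of_nat k + 2) * catalan (Suc k) = (4 * of_nat k + 2) * catalan k"
proof -
  have nz: "(of_nat k + 1 :: rat) \<noteq> 0" by (metis of_nat_Suc of_nat_neq_0 add.commute)
  have nz2: "(of_nat k + 2 :: rat) \<noteq> 0"
    by (metis of_nat_Suc of_nat_neq_0 add.commute add.left_commute one_add_one)
  have "(of_nat k + 2) * catalan (Suc k) = of_nat ((2 * Suc k) choose Suc k)"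
    using nz2 by (simp add: catalan_def add.commute)
  also have "\<dots> = (2 * (2 * of_nat k + 1) * of_nat ((2 * k) choose k)) / (of_nat k + 1)"
    unfolding central_binomial_Suc[of k, symmetric] using nz by simp
  also have "\<dots> = (4 * of_nat k + 2) * catalan k"
    by (simp add: catalan_def algebra_simps)
  finally show ?thesis .
qed

lemma fps_numeral_mult_nth: "(numeral k * f) $ n = numeral k * (f :: 'a :: comm_ring_1 fps) $ n"
  by (simp add: numeral_fps_const)

lemma fps_neg_numeral_mult_nth: "(- numeral k * f) $ n = - numeral k * (f :: 'a :: comm_ring_1 fps) $ n"
  by (simp add: numeral_fps_const)

text \<open>The square root S = 1 - 2 X C of 1 - 4 X satisfies (1 - 4 X) S' = - 2 S, which is the
  two-term recurrence of the closed formula.\<close>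

lemma catalan_rec_eq: "of_nat (catalan_rec n) = catalan n"
proof -
  define C :: "rat fps" where "C = Abs_fps (\<lambda>n. of_nat (catalan_rec n))"
  define S where "S = 1 - 2 * fps_X * C"
  have C: "C = 1 + fps_X * C ^ 2" unfolding C_def by (rule catalan_rec_fps)
  have "S * S = 1 - 4 * fps_X * (C - fps_X * C ^ 2)"
    by (simp add: S_def algebra_simps power2_eq_square)
  also have "C - fps_X * C ^ 2 = 1" using C by (metis add_diff_cancel_right')
  finally have SS: "S * S = 1 - 4 * fps_X" by simp
  \<comment> \<open>Differentiating S^2 = 1 - 4X gives S S' = -2; multiplying this by S yields the
    differential equation without a division.\<close>
  have "fps_deriv (S * S) = - 4" unfolding SS by simp
  then have "2 * (S * fps_deriv S) = 2 * (- 2)" by (simp add: algebra_simps)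
  then have SD: "S * fps_deriv S = - 2" by (metis mult_cancel_left zero_neq_numeral)
  have "(1 - 4 * fps_X) * fps_deriv S = S * (S * fps_deriv S)" unfolding SS[symmetric] by (simp add: ac_simps)
  also have "\<dots> = - 2 * S" unfolding SD by simp
  finally have ode: "fps_deriv S - 4 * (fps_X * fps_deriv S) = - 2 * S" by (simp add: algebra_simps)
  have S_Suc: "S $ Suc k = - 2 * of_nat (catalan_rec k)" for k
  proof -
    have "(2 * fps_X * C) $ Suc k = 2 * C $ k"
      by (simp only: mult.assoc fps_numeral_mult_nth fps_X_mult_nth) simp
    then show ?thesis by (simp add: S_def C_def)
  qed
  \<comment> \<open>Compare coefficients at index k + 1: by \<open>S_Suc\<close> those of S are
    shifted by one against the Catalan numbers.\<close>
  have step: "(of_nat k + 2) * of_nat (catalan_rec (Suc k)) = (4 * of_nat k + 2) * (of_nat (catalan_rec k) :: rat)" for k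
  proof -
    have "(fps_deriv S - 4 * (fps_X * fps_deriv S)) $ Suc k = (- 2 * S) $ Suc k" unfolding ode ..
    then have "of_nat (Suc (Suc k)) * S $ Suc (Suc k) - 4 * (of_nat (Suc k) * S $ Suc k) = - 2 * S $ Suc k"
      by (simp only: fps_sub_nth fps_numeral_mult_nth fps_X_mult_nth fps_deriv_nth fps_neg_numeral_mult_nth) simp
    then show ?thesis unfolding S_Suc by (simp add: algebra_simps)
  qed
  show ?thesis
  proof (induction n)
    case 0
    then show ?case by (simp add: catalan_def)
  next
    case (Suc k)
    have "(of_nat k + 2 :: rat) \<noteq> 0"
      by (metis of_nat_Suc of_nat_neq_0 add.commute add.left_commute one_add_one)
    moreover have "(of_nat k + 2) * of_nat (catalan_rec (Suc k)) = (of_nat k + 2) * catalan (Suc k)"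
      unfolding step Suc.IH catalan_Suc ..
    ultimately show ?case by (metis mult_cancel_left)
  qed
qed

section \<open>Motzkin paths counted by length and starting height\<close>

fun motzkin_height :: "nat \<Rightarrow> nat \<Rightarrow> nat" where
  "motzkin_height 0 h = (if h = 0 then 1 else 0)"
| "motzkin_height (Suc r) h = motzkin_height r h + motzkin_height r (Suc h)
     + (if h > 0 then motzkin_height r (h - 1) else 0)"

text \<open>Paths still start at the origin and may descend to -h, instead of starting at height h.
  So the case h = 0 is the set defining \<open>motzkin\<close>.\<close>

definition motzkin_paths_from :: "nat \<Rightarrow> nat \<Rightarrow> (int \<times> int) list set" where
  "motzkin_paths_from h m = {s. set s \<subseteq> {(1, 1), (1, 0), (1, -1)} \<and>
     sum_list s = (int m, - int h) \<and> (\<forall>k\<le>length s. snd (sum_list (take k s)) + int h \<ge> 0)}"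

lemma all_le_Suc_iff: "(\<forall>k\<le>Suc n. P k) \<longleftrightarrow> P 0 \<and> (\<forall>k\<le>n. P (Suc k))"
  by (metis Suc_le_mono le0 not0_implies_Suc)

lemma motzkin_paths_from_Cons:
  "(x, e) # s \<in> motzkin_paths_from h (Suc m) \<longleftrightarrow> x = 1 \<and> e \<in> {1, 0, -1} \<and>
     0 \<le> int h + e \<and> s \<in> motzkin_paths_from (nat (int h + e)) m"
proof -
  have nn: "(\<forall>k\<le>length s. snd (sum_list (take k s)) + (int h + e) \<ge> 0) \<Longrightarrow> 0 \<le> int h + e"
    by (drule spec[of _ 0]) simp
  have "(\<forall>k\<le>length ((x, e) # s). snd (sum_list (take k ((x, e) # s))) + int h \<ge> 0) \<longleftrightarrow>
     (\<forall>k\<le>length s. snd (sum_list (take k s)) + (int h + e) \<ge> 0)"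
    by (simp add: all_le_Suc_iff ac_simps)
  moreover have "sum_list ((x, e) # s) = (int (Suc m), - int h) \<longleftrightarrow>
      sum_list s = (int (Suc m) - x, - (int h + e))"
    by (cases "sum_list s") auto
  ultimately show ?thesis
    using nn unfolding motzkin_paths_from_def by auto
qed

lemma motzkin_paths_from_0: "motzkin_paths_from h 0 = (if h = 0 then {[]} else {})"
proof -
  have len: "fst (sum_list s) = int (length s)" if "set s \<subseteq> {(1, 1), (1, 0), (1, -1)}" for s :: "(int \<times> int) list"
    using that by (induction s) auto
  have "s = []" if "s \<in> motzkin_paths_from h 0" for s
    using that len[of s] by (auto simp: motzkin_paths_from_def)
  moreover have "[] \<in> motzkin_paths_from h 0 \<longleftrightarrow> h = 0"
    by (auto simp: motzkin_paths_from_def zero_prod_def)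
  ultimately show ?thesis by auto
qed

lemma motzkin_paths_from_Suc:
  "motzkin_paths_from h (Suc m) = (#) (1, 0) ` motzkin_paths_from h m \<union>
     (#) (1, 1) ` motzkin_paths_from (Suc h) m \<union>
     (if h > 0 then (#) (1, -1) ` motzkin_paths_from (h - 1) m else {})"
proof (rule set_eqI)
  fix s
  show "s \<in> motzkin_paths_from h (Suc m) \<longleftrightarrow> s \<in> (#) (1, 0) ` motzkin_paths_from h m \<union>
     (#) (1, 1) ` motzkin_paths_from (Suc h) m \<union>
     (if h > 0 then (#) (1, -1) ` motzkin_paths_from (h - 1) m else {})"
  proof (cases s)
    case Nil
    then show ?thesis by (auto simp: motzkin_paths_from_def zero_prod_def)
  next
    case (Cons xe s')
    obtain x e where "xe = (x, e)" by (cases xe)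
    have nats: "nat (int h + 1) = Suc h" "h > 0 \<Longrightarrow> nat (int h - 1) = h - 1" by auto
    show ?thesis unfolding Cons \<open>xe = (x, e)\<close> motzkin_paths_from_Cons
      using nats by (cases "h > 0") (auto simp: image_iff)
  qed
qed

lemma card_motzkin_paths_from:
  "finite (motzkin_paths_from h m) \<and> card (motzkin_paths_from h m) = motzkin_height m h"
proof (induction m arbitrary: h)
  case 0
  then show ?case by (simp add: motzkin_paths_from_0)
next
  case (Suc m)
  let ?A = "(#) (1, 0) ` motzkin_paths_from h m" and ?B = "(#) (1, 1) ` motzkin_paths_from (Suc h) m"
    and ?C = "if h > 0 then (#) (1, -1) ` motzkin_paths_from (h - 1) m else {}"
  have fin: "finite ?A" "finite ?B" "finite ?C" using Suc.IH by auto
  have card_cons: "card ((#) x ` X) = card X" for x :: "int \<times> int" and X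
    by (simp add: card_image)
  have "card (?A \<union> ?B \<union> ?C) = card (?A \<union> ?B) + card ?C"
    by (rule card_Un_disjoint) (use fin in auto)
  also have "card (?A \<union> ?B) = card ?A + card ?B"
    by (rule card_Un_disjoint) (use fin in auto)
  finally show ?case
    unfolding motzkin_paths_from_Suc using fin Suc.IH by (simp add: card_cons)
qed

lemma motzkin_eq: "motzkin m = motzkin_height m 0"
  using card_motzkin_paths_from[of 0 m]
  by (simp add: motzkin_def motzkin_paths_def motzkin_paths_from_def)

text \<open>Since y has zero constant coefficient, coefficient n of the right-hand side involves
  only coefficients below n of the family, for all heights at once. So the infinite system has at
  most one solution.\<close>

lemma fps_power_recursion_unique:
  fixes G H :: "nat \<Rightarrow> 'a :: comm_ring_1 fps"
  assumes "y $ 0 = 0"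
    and "\<And>h. G h = (if h = 0 then y else 0) + y * (G h + G (Suc h) + (if h > 0 then G (h - 1) else 0))"
    and "\<And>h. H h = (if h = 0 then y else 0) + y * (H h + H (Suc h) + (if h > 0 then H (h - 1) else 0))"
  shows "G h = H h"
proof (rule fps_ext)
  fix n
  show "G h $ n = H h $ n"
  proof (induction n arbitrary: h rule: less_induct)
    case (less n)
    let ?Z = "\<lambda>F. F h + F (Suc h) + (if h > 0 then F (h - 1) else 0)"
    have "(y * ?Z G) $ n = (y * ?Z H) $ n"
      unfolding fps_mult_nth
    proof (rule sum.cong[OF refl])
      fix i assume "i \<in> {0..n}"
      show "y $ i * ?Z G $ (n - i) = y $ i * ?Z H $ (n - i)"
      proof (cases "i = 0")
        case True
        then show ?thesis using assms(1) by simp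
      next
        case False
        then have "n - i < n" using \<open>i \<in> {0..n}\<close> by simp
        then show ?thesis using less.IH by simp
      qed
    qed
    then show ?case by (subst assms(2), subst assms(3)) simp
  qed
qed

text \<open>\<open>G h\<close> sums the weighted words from height h, shifted by one because n
  cycles have n - 1 gaps. By \<open>ballot_sum_blocks\<close> it solves a system in which y = c - 1
  stands for one block. Composing the system of the Motzkin series \<open>M h\<close> with y and
  multiplying by y gives the same system.\<close>

lemma A_set_fps:
  fixes c m :: "rat fps"
  defines "c \<equiv> Abs_fps catalan" and "m \<equiv> Abs_fps (\<lambda>j. of_nat (motzkin j))"
  shows "(c - 1) * (m oo (c - 1)) =
    Abs_fps (\<lambda>n. if n = 0 then 0 else of_nat (card (A_set (3 * n))))"
proof -
  define y where "y = c - 1"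
  define G :: "nat \<Rightarrow> rat fps"
    where "G h = Abs_fps (\<lambda>n. if n = 0 then 0 else of_nat (ballot_sum 1 h (n - 1)))" for h
  define M :: "nat \<Rightarrow> rat fps" where "M h = Abs_fps (\<lambda>r. of_nat (motzkin_height r h))" for h
  have y0: "y $ 0 = 0" by (simp add: y_def c_def catalan_def)
  have y_Suc: "y $ Suc n = of_nat (catalan_rec (Suc n))" for n
    by (simp add: y_def c_def catalan_rec_eq del: catalan_rec.simps)
  have G: "G h = (if h = 0 then y else 0) + y * (G h + G (Suc h) + (if h > 0 then G (h - 1) else 0))" for h
  proof (rule fps_ext)
    fix n
    let ?Z = "G h + G (Suc h) + (if h > 0 then G (h - 1) else 0)"
    show "G h $ n = ((if h = 0 then y else 0) + y * ?Z) $ n"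
    proof (cases n)
      case 0
      then show ?thesis using y0 by (simp add: G_def)
    next
      case (Suc N)
      let ?z = "\<lambda>r. ballot_sum 1 h r + ballot_sum 1 (Suc h) r + (if h > 0 then ballot_sum 1 (h - 1) r else 0)"
      have Z0: "?Z $ 0 = 0" and Z_Suc: "?Z $ Suc r = of_nat (?z r)" for r
        by (simp_all add: G_def)
      have "(y * ?Z) $ Suc N = (\<Sum>i\<le>Suc N. y $ i * ?Z $ (Suc N - i))"
        by (simp only: fps_mult_nth atMost_atLeast0)
      \<comment> \<open>The term i = 0 vanishes because y has no constant coefficient, and the last
        term, removed next, because no \<open>G\<close> has one.\<close>
      also have "\<dots> = (\<Sum>s\<le>N. y $ Suc s * ?Z $ (N - s))"
        by (subst sum.atMost_Suc_shift) (simp add: y0)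
      also have "\<dots> = (\<Sum>s<N. y $ Suc s * ?Z $ (N - s))"
        unfolding lessThan_Suc_atMost[symmetric] sum.lessThan_Suc using Z0 by simp
      also have "\<dots> = (\<Sum>s<N. of_nat (catalan_rec (1 + s) * ?z (N - 1 - s)))"
      proof (rule sum.cong[OF refl])
        fix s assume "s \<in> {..<N}"
        then have "N - s = Suc (N - 1 - s)" by auto
        then show "y $ Suc s * ?Z $ (N - s) = of_nat (catalan_rec (1 + s) * ?z (N - 1 - s))"
          unfolding y_Suc by (simp only: Z_Suc of_nat_mult plus_1_eq_Suc)
      qed
      finally have "(y * ?Z) $ Suc N = of_nat (\<Sum>s<N. catalan_rec (1 + s) * ?z (N - 1 - s))"
        by (simp only: of_nat_sum)
      moreover have "G h $ Suc N = of_nat (ballot_sum 1 h N)" by (simp add: G_def)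
      moreover have "(if h = 0 then y else 0) $ Suc N = of_nat (if h = 0 then catalan_rec (1 + N) else 0)"
        using y_Suc by (simp del: catalan_rec.simps)
      ultimately show ?thesis
        unfolding Suc ballot_sum_blocks[of 1 h N] by (simp only: fps_add_nth of_nat_add)
    qed
  qed
  have M: "M h = (if h = 0 then 1 else 0) + fps_X * (M h + M (Suc h) + (if h > 0 then M (h - 1) else 0))" for h
  proof (rule fps_ext)
    fix n
    show "M h $ n = ((if h = 0 then 1 else 0) + fps_X * (M h + M (Suc h) + (if h > 0 then M (h - 1) else 0))) $ n"
      by (cases n) (simp_all add: M_def)
  qed
  have H: "y * (M h oo y) = (if h = 0 then y else 0) + y * (y * (M h oo y) + y * (M (Suc h) oo y)
      + (if h > 0 then y * (M (h - 1) oo y) else 0))" for h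
  proof -
    have "M h oo y = ((if h = 0 then 1 else 0) + fps_X * (M h + M (Suc h) + (if h > 0 then M (h - 1) else 0))) oo y"
      using M[of h] by simp
    also have "\<dots> = (if h = 0 then 1 else 0) + y * ((M h oo y) + (M (Suc h) oo y) + (if h > 0 then M (h - 1) oo y else 0))"
      by (simp add: fps_compose_add_distrib fps_compose_mult_distrib[OF y0] y0)
    finally have "y * (M h oo y) = y * ((if h = 0 then 1 else 0)
        + y * ((M h oo y) + (M (Suc h) oo y) + (if h > 0 then M (h - 1) oo y else 0)))"
      by (rule arg_cong)
    then show ?thesis by (cases "h = 0") (simp_all add: algebra_simps)
  qed
  have "G 0 = y * (M 0 oo y)"
    by (rule fps_power_recursion_unique[where H = "\<lambda>h. y * (M h oo y)", OF y0 G H])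
  moreover have "M 0 = m" by (simp add: M_def m_def motzkin_eq)
  moreover have "G 0 = Abs_fps (\<lambda>n. if n = 0 then 0 else of_nat (card (A_set (3 * n))))"
  proof (rule fps_ext)
    fix n
    show "G 0 $ n = Abs_fps (\<lambda>n. if n = 0 then 0 else of_nat (card (A_set (3 * n)))) $ n"
      using card_A_set[of "n - 1"] by (cases n) (simp_all add: G_def)
  qed
  ultimately show ?thesis by (simp add: y_def)
qed

section \<open>Compositions and the recurrence for V\<close>

lemma finite_compositions: "finite (compositions n k)"
proof (rule finite_subset)
  show "compositions n k \<subseteq> {xs. set xs \<subseteq> {..n} \<and> length xs = k}"
    using member_le_sum_list by (fastforce simp: compositions_def)
qed (simp add: finite_lists_length_eq)

lemma compositions_0: "compositions n 0 = (if n = 0 then {[]} else {})"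
  by (auto simp: compositions_def)

lemma compositions_Suc: "compositions n (Suc k) = (\<Union>x\<in>{1..n}. (#) x ` compositions (n - x) k)"
proof (rule set_eqI)
  fix xs
  show "xs \<in> compositions n (Suc k) \<longleftrightarrow> xs \<in> (\<Union>x\<in>{1..n}. (#) x ` compositions (n - x) k)"
  proof (cases xs)
    case Nil
    then show ?thesis by (auto simp: compositions_def)
  next
    case (Cons x ys)
    have "x # ys \<in> (\<Union>z\<in>{1..n}. (#) z ` compositions (n - z) k) \<longleftrightarrow>
        x \<in> {1..n} \<and> ys \<in> compositions (n - x) k"
      by blast
    then show ?thesis unfolding Cons by (auto simp: compositions_def)
  qed
qed

lemma compositions_empty: "n < k \<Longrightarrow> compositions n k = {}"
proof (induction k arbitrary: n)
  case (Suc k)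
  then show ?case by (auto simp: compositions_Suc)
qed simp

lemma sum_compositions_Suc:
  "(\<Sum>xs\<in>compositions n (Suc k). prod_list (map a xs)) =
     (\<Sum>x = 1..n. a x * (\<Sum>xs\<in>compositions (n - x) k. prod_list (map a xs)))"
  for a :: "nat \<Rightarrow> nat"
proof -
  have "(\<Sum>xs\<in>compositions n (Suc k). prod_list (map a xs)) =
      (\<Sum>x = 1..n. \<Sum>xs\<in>(#) x ` compositions (n - x) k. prod_list (map a xs))"
    unfolding compositions_Suc by (rule sum.UNION_disjoint) (auto simp: finite_compositions)
  also have "\<dots> = (\<Sum>x = 1..n. a x * (\<Sum>xs\<in>compositions (n - x) k. prod_list (map a xs)))"
    by (rule sum.cong) (simp_all add: sum.reindex sum_distrib_left)
  finally show ?thesis .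
qed

text \<open>Iterating v = a + a v expands v over all compositions; the induction removes the first
  part x.\<close>

lemma sum_compositions:
  fixes a v :: "nat \<Rightarrow> nat"
  assumes "\<And>n. 1 \<le> n \<Longrightarrow> v n = a n + (\<Sum>k = 1..<n. a k * v (n - k))" and "1 \<le> n"
  shows "(\<Sum>k = 1..n. \<Sum>xs\<in>compositions n k. prod_list (map a xs)) = v n"
  using assms(2)
proof (induction n rule: less_induct)
  case (less n)
  define T where "T n k = (\<Sum>xs\<in>compositions n k. prod_list (map a xs))" for n k
  \<comment> \<open>Summands with j > n - x are empty. For x = n only the empty composition of 0
    remains, which contributes 1.\<close>
  have total: "(\<Sum>j<n. T (n - x) j) = (if x = n then 1 else v (n - x))" if x: "x \<in> {1..n}" for x
  proof -
    have "(\<Sum>j<n. T (n - x) j) = (\<Sum>j\<le>n - x. T (n - x) j)"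
      by (rule sum.mono_neutral_right) (use x in \<open>auto simp: T_def compositions_empty\<close>)
    also have "\<dots> = T (n - x) 0 + (\<Sum>j = 1..n - x. T (n - x) j)"
      by (simp add: atMost_atLeast0 sum.atLeast_Suc_atMost)
    also have "\<dots> = (if x = n then 1 else v (n - x))"
      using less.IH[of "n - x"] x by (auto simp: T_def compositions_0)
    finally show ?thesis .
  qed
  have "(\<Sum>k = 1..n. T n k) = (\<Sum>j<n. T n (Suc j))"
    by (rule sum.reindex_bij_witness[where i = Suc and j = "\<lambda>k. k - 1"]) auto
  also have "\<dots> = (\<Sum>j<n. \<Sum>x = 1..n. a x * T (n - x) j)"
    unfolding T_def sum_compositions_Suc ..
  also have "\<dots> = (\<Sum>x = 1..n. a x * (\<Sum>j<n. T (n - x) j))"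
    by (subst sum.swap) (simp add: sum_distrib_left)
  also have "\<dots> = (\<Sum>x = 1..n. a x * (if x = n then 1 else v (n - x)))"
    by (rule sum.cong[OF refl]) (simp only: total)
  also have "\<dots> = (\<Sum>x\<in>insert n {1..<n}. a x * (if x = n then 1 else v (n - x)))"
    by (rule sum.cong) (use less.prems in auto)
  also have "\<dots> = a n + (\<Sum>x = 1..<n. a x * v (n - x))"
    by simp
  also have "\<dots> = v n" using assms(1)[OF less.prems] by simp
  finally show ?case by (simp add: T_def)
qed

theorem theorem3p12:
  fixes a :: "nat \<Rightarrow> nat" and A B c m :: "rat fps"
  defines "a \<equiv> \<lambda>j. card (A_set (3 * j))"
    and "c \<equiv> Abs_fps catalan"
    and "m \<equiv> Abs_fps (\<lambda>j. of_nat (motzkin j))"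
    and "B \<equiv> Abs_fps (\<lambda>n. if n \<ge> 1 then of_nat (card (Av_star (3 * n) [1, 3, 2])) else 0)"
    and "A \<equiv> (c - 1) * (m oo (c - 1))"
  shows "(\<forall>n\<ge>1. card (Av_star (3 * n) [1, 3, 2]) =
            2 * (\<Sum>k = 1..n. \<Sum>xs\<in>compositions n k. prod_list (map a xs)))
         \<and> B = 2 * A / (1 - A)"
proof
  define v where "v n = card (V312 (3 * n))" for n
  have v: "v n = a n + (\<Sum>k = 1..<n. a k * v (n - k))" if "1 \<le> n" for n
    using card_V312[OF that] by (simp add: v_def a_def)
  have Av: "card (Av_star (3 * n) [1, 3, 2]) = 2 * v n" if "1 \<le> n" for n
    using card_Av_star_eq[of "3 * n"] that by (simp add: v_def)
  show "\<forall>n\<ge>1. card (Av_star (3 * n) [1, 3, 2]) =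
            2 * (\<Sum>k = 1..n. \<Sum>xs\<in>compositions n k. prod_list (map a xs))"
    using Av sum_compositions[of v a, OF v] by simp
  define V :: "rat fps" where "V = Abs_fps (\<lambda>n. if n \<ge> 1 then of_nat (v n) else 0)"
  have A: "A = Abs_fps (\<lambda>n. if n = 0 then 0 else of_nat (a n))"
    unfolding A_def c_def m_def A_set_fps a_def ..
  \<comment> \<open>A and V have zero constant coefficients, so the convolution loses its terms at 0
    and n and becomes the recurrence \<open>v\<close>.\<close>
  have "V = A + A * V"
  proof (rule fps_ext)
    fix n
    show "V $ n = (A + A * V) $ n"
    proof (cases "n = 0")
      case True
      then show ?thesis by (simp add: V_def A)
    next
      case False
      have "(A * V) $ n = (\<Sum>i = 0..n. A $ i * V $ (n - i))" by (rule fps_mult_nth)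
      also have "\<dots> = (\<Sum>i = 1..<n. A $ i * V $ (n - i))"
        by (rule sum.mono_neutral_right) (auto simp: A V_def)
      also have "\<dots> = (\<Sum>i = 1..<n. of_nat (a i * v (n - i)))"
        by (rule sum.cong) (auto simp: A V_def)
      finally have "(A + A * V) $ n = of_nat (a n + (\<Sum>i = 1..<n. a i * v (n - i)))"
        using False by (simp add: A)
      then show ?thesis using v[of n] False by (simp add: V_def)
    qed
  qed
  then have "V * (1 - A) = A" by (simp add: algebra_simps)
  moreover have "B = 2 * V"
    by (rule fps_ext) (simp add: B_def V_def Av fps_numeral_mult_nth del: One_nat_def)
  ultimately have "B * (1 - A) = 2 * A" by (simp add: mult.assoc)
  \<comment> \<open>The constant coefficient of 1 - A is 1, so it may be cancelled.\<close>
  moreover have "1 - A \<noteq> 0"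
  proof
    assume "1 - A = 0"
    then have "(1 - A) $ 0 = 0" by simp
    then show False by (simp add: A)
  qed
  ultimately show "B = 2 * A / (1 - A)"
    by (metis nonzero_mult_div_cancel_right)
qed

end
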